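(* Let $\mathbb E$, $f,g,h,\phi$, $F=f+g-h$ and the constants $L>0$, $l\ge 0$, $\delta\in(0,1)$ satisfy the standing assumptions (a)--(d) listed in the context, and let $\{x^k\}$ be a sequence generated by the DCAe algorithm described in the context. Define $\Phi:\mathbb E\times\mathbb E\to(-\infty,+\infty]$ by $$\Phi(x,y)=F(x)+\frac{(1+\delta)L}{2}D_\phi(y,x).$$ Suppose in addition that: (i) $\Phi$ satisfies the Kurdyka--Łojasiewicz (KL) property at every point of $\mathrm{dom}\,\partial^L\Phi$; (ii) $\nabla f$ and $\nabla\phi$ are Lipschitz continuous on every bounded subset of $\mathbb E$; (iii) $h$ is differentiable and $\nabla h$ is Lipschitz continuous on every bounded subset of $\mathbb E$. If $\{x^k\}$ is bounded, then $\{x^k\}$ converges to a critical point of the problem $\min_{x\in\mathbb E}F(x)$.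
   Context: $\mathbb E$ is a finite-dimensional real linear space with inner product $\langle\cdot,\cdot\rangle$ and induced norm $\|\cdot\|$. The problem considered is $$\min_{x\in\mathbb E} F(x):=f(x)+g(x)-h(x).$$ Standing assumptions: (a) $f:\mathbb E\to\mathbb R$ is a (possibly nonconvex) continuously differentiable function, and $\phi:\mathbb E\to\mathbb R$ is a strongly convex continuously differentiable function such that $L\phi-f$ and $l\phi+f$ are convex, where $L>0$ and $l\ge 0$ are constants. (b) $g:\mathbb E\to\mathbb R\cup\{+\infty\}$ is a proper, lower semicontinuous, convex function. (c) $h:\mathbb E\to\mathbb R$ is a convex function. (d) $F$ is bounded from below. A function $J$ is strongly convex if $J-(\rho/2)\|\cdot\|^2$ is convex for some $\rho>0$. Define $D_\phi(x,y):=\phi(x)-[\phi(y)+\langle\nabla\phi(y),x-y\rangle]$ and $G(x):=L\phi(x)+g(x)$. For a convex function $J$, $\partial J(x)=\{y: J(z)\ge J(x)+\langle z-x,y\rangle\ \forall z\in\mathbb E\}$ denotes the convex subdifferential. A point $x^*$ is a critical point of the problem if $[\nabla f(x^* )+\partial g(x^* )]\cap\partial h(x^* )\ne\emptyset$. DCAe algorithm: choose $x^0=x^{-1}\in\mathbb E$ and $\delta\in(0,1)$, with $L,l$ as in assumption (a). For $k=0,1,2,\dots$: 1. Compute $y^k=x^k+\beta_k(x^k-x^{k-1})$, where the extrapolation parameter $\beta_k$ satisfies $(L+l)D_\phi(x^k,y^k)\le\delta L\,D_\phi(x^{k-1},x^k)$. 2. Choose $\xi^k\in\partial h(x^k)$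 and let $x^{k+1}$ be a solution of the convex problem $\min_{x\in\mathbb E}\{G(x)-\langle L\nabla\phi(y^k)-\nabla f(y^k)+\xi^k,\,x\rangle\}$. Subdifferentials: for a lower semicontinuous function $J$ with values in $(-\infty,+\infty]$ on a finite-dimensional space and $x^*\in\mathrm{dom}(J)=\{x:J(x)<+\infty\}$, the Fréchet subdifferential is $$\partial^FJ(x^* )=\left\{u:\liminf_{x\to x^*}\frac{J(x)-J(x^* )-\langle u,x-x^*\rangle}{\|x-x^*\|}\ge 0\right\},$$ and the limiting subdifferential $\partial^LJ(x^* )$ is the set of all $u$ for which there exist $x^k\to x^*$ with $J(x^k)\to J(x^* )$ and $u^k\in\partial^FJ(x^k)$ with $u^k\to u$. $\mathrm{dom}\,\partial^LJ$ is the set of points where $\partial^LJ$ is nonempty. KL property: for $\eta\in(0,\infty]$, let $\mathcal M_\eta$ be the class of continuous concave functions $\psi:[0,\eta)\to[0,\infty)$ such that $\psi(0)=0$, $\psi$ is continuously differentiable on $(0,\eta)$, and $\psi'(t)>0$ for all $t\in(0,\eta)$. A lower semicontinuous function $J$ satisfies the KL property at $u^*\in\mathrm{dom}\,\partial^LJ$ if there exist $\eta>0$, a neighborhood $\mathcal V$ of $u^*$ and $\psi\in\mathcal M_\eta$ such that for all $u\in\mathcal V$ with $J(u^* )<J(u)<J(u^* )+\eta$ one has $\psi'(J(u)-J(u^* ))\,\mathrm{dist}(0,\partial^LJ(u))\ge 1$, where $\mathrm{dist}(0,S)=\inf_{s\in S}\|s\|$ (equal to $+\infty$ if $S=\emptyset$).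 *)

theory Defs
  imports "HOL-Analysis.Analysis"
begin

section \<open>Differentiability and convexity\<close>

definition grad :: "('a::euclidean_space \<Rightarrow> real) \<Rightarrow> 'a \<Rightarrow> 'a" where
  "grad f x = (THE D. GDERIV f x :> D)"

definition cont_diff :: "('a::euclidean_space \<Rightarrow> real) \<Rightarrow> bool" where
  "cont_diff f \<longleftrightarrow> (\<forall>x. f differentiable (at x)) \<and> continuous_on UNIV (grad f)"

definition lipschitz_on_bounded :: "('a::euclidean_space \<Rightarrow> 'a) \<Rightarrow> bool" where
  "lipschitz_on_bounded T \<longleftrightarrow> (\<forall>B. bounded B \<longrightarrow> (\<exists>M. M-lipschitz_on B T))"

definition strongly_convex :: "('a::euclidean_space \<Rightarrow> real) \<Rightarrow> bool" where
  "strongly_convex J \<longleftrightarrow> (\<exists>\<rho>>0. convex_on UNIV (\<lambda>x. J x - \<rho> / 2 * (norm x)\<^sup>2))"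

text \<open>Functions with values in \<open>(-\<infinity>, +\<infinity>]\<close> are modelled as \<^typ>\<open>ereal\<close>-valued functions that never
  take the value \<open>-\<infinity>\<close>; for such functions the sums below never have the form \<open>\<infinity> - \<infinity>\<close>.\<close>

definition proper :: "('a \<Rightarrow> ereal) \<Rightarrow> bool" where
  "proper J \<longleftrightarrow> (\<forall>x. J x \<noteq> -\<infinity>) \<and> (\<exists>x. J x < \<infinity>)"

definition lsc :: "('a::topological_space \<Rightarrow> ereal) \<Rightarrow> bool" where
  "lsc J \<longleftrightarrow> (\<forall>x. J x \<le> Liminf (at x) J)"

definition econvex :: "('a::real_vector \<Rightarrow> ereal) \<Rightarrow> bool" where
  "econvex J \<longleftrightarrow> (\<forall>x y. \<forall>t\<in>{0<..<1}.
     J ((1 - t) *\<^sub>R x + t *\<^sub>R y) \<le> ereal (1 - t) * J x + ereal t * J y)"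

definition bregman :: "('a::euclidean_space \<Rightarrow> real) \<Rightarrow> 'a \<Rightarrow> 'a \<Rightarrow> real" where
  "bregman \<phi> x y = \<phi> x - (\<phi> y + grad \<phi> y \<bullet> (x - y))"


section \<open>Subdifferentials\<close>

definition subdiff :: "('a::real_inner \<Rightarrow> ereal) \<Rightarrow> 'a \<Rightarrow> 'a set" where
  "subdiff J x = {y. \<forall>z. J z \<ge> J x + ereal ((z - x) \<bullet> y)}"

definition frechet_subdiff :: "('a::euclidean_space \<Rightarrow> ereal) \<Rightarrow> 'a \<Rightarrow> 'a set" where
  "frechet_subdiff J x = {u. J x < \<infinity> \<and>
     Liminf (at x) (\<lambda>z. (J z - J x - ereal (u \<bullet> (z - x))) / ereal (norm (z - x))) \<ge> 0}"

definition limiting_subdiff :: "('a::euclidean_space \<Rightarrow> ereal) \<Rightarrow> 'a \<Rightarrow> 'a set" where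
  "limiting_subdiff J x = {u. J x < \<infinity> \<and>
     (\<exists>X U. X \<longlonglongrightarrow> x \<and> (\<lambda>k. J (X k)) \<longlonglongrightarrow> J x \<and>
        (\<forall>k. U k \<in> frechet_subdiff J (X k)) \<and> U \<longlonglongrightarrow> u)}"

definition dom_limiting_subdiff :: "('a::euclidean_space \<Rightarrow> ereal) \<Rightarrow> 'a set" where
  "dom_limiting_subdiff J = {x. limiting_subdiff J x \<noteq> {}}"


section \<open>The Kurdyka-Lojasiewicz property\<close>

text \<open>The library functions \<open>infdist\<close> and \<open>setdist\<close> are \<open>0\<close> on the empty set; this one is \<open>\<infinity>\<close>.\<close>

definition dist0 :: "'a::real_normed_vector set \<Rightarrow> ereal" where
  "dist0 S = (INF s\<in>S. ereal (norm s))"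

definition desingularizing :: "ereal \<Rightarrow> (real \<Rightarrow> real) \<Rightarrow> bool" where
  "desingularizing \<eta> \<psi> \<longleftrightarrow>
     (\<forall>t\<in>{t. 0 \<le> t \<and> ereal t < \<eta>}. 0 \<le> \<psi> t) \<and>
     continuous_on {t. 0 \<le> t \<and> ereal t < \<eta>} \<psi> \<and>
     concave_on {t. 0 \<le> t \<and> ereal t < \<eta>} \<psi> \<and>
     \<psi> 0 = 0 \<and>
     (\<forall>t\<in>{t. 0 < t \<and> ereal t < \<eta>}. \<psi> differentiable (at t)) \<and>
     continuous_on {t. 0 < t \<and> ereal t < \<eta>} (deriv \<psi>) \<and>
     (\<forall>t\<in>{t. 0 < t \<and> ereal t < \<eta>}. deriv \<psi> t > 0)"

definition KL_at :: "('a::euclidean_space \<Rightarrow> ereal) \<Rightarrow> 'a \<Rightarrow> bool" where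
  "KL_at J u0 \<longleftrightarrow> (\<exists>\<eta>::ereal. \<eta> > 0 \<and> (\<exists>V \<psi>. open V \<and> u0 \<in> V \<and> desingularizing \<eta> \<psi> \<and>
     (\<forall>u\<in>V. J u0 < J u \<and> J u < J u0 + \<eta> \<longrightarrow>
        ereal (deriv \<psi> (real_of_ereal (J u - J u0))) * dist0 (limiting_subdiff J u) \<ge> 1)))"


section \<open>The difference-of-convex problem and the algorithm\<close>

definition objective ::
  "('a \<Rightarrow> real) \<Rightarrow> ('a \<Rightarrow> ereal) \<Rightarrow> ('a \<Rightarrow> real) \<Rightarrow> 'a \<Rightarrow> ereal" where
  "objective f g h x = ereal (f x) + g x - ereal (h x)"

definition critical_point ::
  "('a::euclidean_space \<Rightarrow> real) \<Rightarrow> ('a \<Rightarrow> ereal) \<Rightarrow> ('a \<Rightarrow> real) \<Rightarrow> 'a \<Rightarrow> bool" where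
  "critical_point f g h x \<longleftrightarrow>
     ((\<lambda>v. grad f x + v) ` subdiff g x) \<inter> subdiff (\<lambda>z. ereal (h z)) x \<noteq> {}"

text \<open>\<open>prev x k\<close> is \<open>x\<^sup>k\<^sup>-\<^sup>1\<close>, with the convention \<open>x\<^sup>-\<^sup>1 = x\<^sup>0\<close>.\<close>

definition prev :: "(nat \<Rightarrow> 'a) \<Rightarrow> nat \<Rightarrow> 'a" where
  "prev x k = (case k of 0 \<Rightarrow> x 0 | Suc j \<Rightarrow> x j)"

definition DCAe_sequence ::
  "('a::euclidean_space \<Rightarrow> real) \<Rightarrow> ('a \<Rightarrow> ereal) \<Rightarrow> ('a \<Rightarrow> real) \<Rightarrow> ('a \<Rightarrow> real) \<Rightarrow>
   real \<Rightarrow> real \<Rightarrow> real \<Rightarrow> (nat \<Rightarrow> 'a) \<Rightarrow> bool" where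
  "DCAe_sequence f g h \<phi> L l \<delta> x \<longleftrightarrow>
     (\<exists>(y :: nat \<Rightarrow> 'a) (\<beta> :: nat \<Rightarrow> real) (\<xi> :: nat \<Rightarrow> 'a). \<forall>k.
        y k = x k + \<beta> k *\<^sub>R (x k - prev x k) \<and>
        (L + l) * bregman \<phi> (x k) (y k) \<le> \<delta> * L * bregman \<phi> (prev x k) (x k) \<and>
        \<xi> k \<in> subdiff (\<lambda>z. ereal (h z)) (x k) \<and>
        is_arg_min
          (\<lambda>z. (ereal (L * \<phi> z) + g z) -
               ereal ((L *\<^sub>R grad \<phi> (y k) - grad f (y k) + \<xi> k) \<bullet> z))
          (\<lambda>_. True) (x (Suc k)))"

definition merit ::
  "('a::euclidean_space \<Rightarrow> real) \<Rightarrow> ('a \<Rightarrow> ereal) \<Rightarrow> ('a \<Rightarrow> real) \<Rightarrow> ('a \<Rightarrow> real) \<Rightarrow>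
   real \<Rightarrow> real \<Rightarrow> 'a \<times> 'a \<Rightarrow> ereal" where
  "merit f g h \<phi> L \<delta> = (\<lambda>(x, y).
     objective f g h x + ereal ((1 + \<delta>) * L / 2 * bregman \<phi> y x))"

end

theory Submission
  imports Defs
begin

text \<open>
  The merit function \<open>\<Phi>\<close> decreases along the pairs \<open>(x (k + 1), x k)\<close> of successive iterates by at
  least a multiple of the squared step length, by a standard estimate for proximal gradient methods
  together with the bound on the extrapolation (\<open>merit_decrease\<close>). Hence the step lengths tend to \<open>0\<close>, and
  passing to the limit in the optimality conditions of the subproblems shows that every cluster point
  is critical and that \<open>\<Phi>\<close> takes its limit value there. What remains is that the bounded sequence has
  only one cluster point, and this is where the KL property enters.

  To use it, \<open>\<Phi>\<close> must have a limiting subgradient at \<open>(x (k + 1), x k)\<close> whose norm is bounded by a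
  multiple of the last two step lengths. This is the delicate point. The Bregman term
  involves \<open>grad \<phi>\<close>, which is only locally Lipschitz, so \<open>\<Phi>\<close> is not a convex function plus a smooth one,
  and no exact sum rule gives its subdifferential. Instead, \<open>merit_minorant\<close> shows directly
  that \<open>\<Phi>\<close> decreases near such a pair at most at a rate \<open>\<kappa>\<close> of the required size, and
  \<open>limiting_subgradient_of_linear_minorant\<close> shows by proximal penalisation that any lower semicontinuous
  function of this kind has a limiting subgradient of norm at most \<open>2 * \<kappa>\<close>.

  Given this, the KL inequality near one cluster point \<open>xs\<close> and the concavity of the desingularizing
  function bound each step by half of the average of the two preceding steps plus a telescoping term.
  In \<open>KL_descent_convergence\<close> this yields a quantity that controls the distance to \<open>xs\<close>, does not increase
  once it is small, and is arbitrarily small along the subsequence converging to \<open>xs\<close>. So the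
  whole sequence converges to \<open>xs\<close>.
\<close>

section \<open>Gradients and convexity\<close>

lemma has_derivative_grad:
  fixes f :: "'a::euclidean_space \<Rightarrow> real"
  assumes "f differentiable (at x)"
  shows "(f has_derivative (\<lambda>d. d \<bullet> grad f x)) (at x)"
proof -
  obtain f' where f': "(f has_derivative f') (at x)"
    using assms unfolding differentiable_def by blast
  then have lin: "linear f'"
    using has_derivative_linear by blast
  define D where "D = adjoint f' 1"
  have "f' = (\<lambda>d. d \<bullet> D)"
    using adjoint_works[OF lin, of _ 1] by (auto simp: D_def)
  then have D: "GDERIV f x :> D"
    using f' by (simp add: gderiv_def)
  have "grad f x = D"
    unfolding grad_def
  proof (rule the_equality[of _ D])
    fix E assume "GDERIV f x :> E"
    then have "(\<lambda>d. d \<bullet> E) = (\<lambda>d. d \<bullet> D)"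
      using D unfolding gderiv_def by (rule has_derivative_unique)
    then show "E = D"
      by (simp add: fun_eq_iff vector_eq_ldot)
  qed (fact D)
  with D show ?thesis
    by (simp add: gderiv_def)
qed

lemma directional_derivative:
  fixes q :: "'a::euclidean_space \<Rightarrow> real"
  assumes "(q has_derivative (\<lambda>d. d \<bullet> D)) (at x)"
  shows "((\<lambda>t. (q (x + t *\<^sub>R d) - q x) / t) \<longlongrightarrow> d \<bullet> D) (at_right 0)"
proof -
  have "((\<lambda>t. x + t *\<^sub>R d) has_derivative (\<lambda>t. t *\<^sub>R d)) (at 0)"
    by (auto intro!: derivative_eq_intros)
  then have "((\<lambda>t. q (x + t *\<^sub>R d)) has_derivative (\<lambda>t. (t *\<^sub>R d) \<bullet> D)) (at 0)"
    using has_derivative_compose[of "\<lambda>t. x + t *\<^sub>R d" "\<lambda>t. t *\<^sub>R d" 0 UNIV q "\<lambda>d. d \<bullet> D"] assms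
    by simp
  then have "((\<lambda>t. q (x + t *\<^sub>R d)) has_field_derivative d \<bullet> D) (at 0)"
    by (simp add: has_field_derivative_def mult.commute[of _ "d \<bullet> D"])
  then have "((\<lambda>t. (q (x + t *\<^sub>R d) - q x) / t) \<longlongrightarrow> d \<bullet> D) (at 0)"
    by (simp add: DERIV_def)
  then show ?thesis
    by (rule tendsto_mono[rotated]) (simp add: at_le)
qed

text \<open>
  Both first-order characterisations used below, of convexity and of minimality, come from
  bounding difference quotients along a segment, and this lemma packages the passage to the limit.
\<close>

lemma directional_derivative_ge:
  fixes q :: "'a::euclidean_space \<Rightarrow> real"
  assumes "(q has_derivative (\<lambda>d. d \<bullet> D)) (at x)"
    and "\<And>t. 0 < t \<Longrightarrow> t < 1 \<Longrightarrow> t * b \<le> q (x + t *\<^sub>R d) - q x"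
  shows "b \<le> d \<bullet> D"
proof (rule tendsto_lowerbound[OF directional_derivative[OF assms(1), of d]])
  have "\<forall>\<^sub>F t in at_right 0. t \<in> {0<..<1::real}"
    by (rule eventually_at_right_real) simp
  then show "\<forall>\<^sub>F t in at_right 0. b \<le> (q (x + t *\<^sub>R d) - q x) / t"
    by eventually_elim (use assms(2) in \<open>auto simp: pos_le_divide_eq mult.commute\<close>)
qed simp

lemma convex_above_gradient:
  fixes q :: "'a::euclidean_space \<Rightarrow> real"
  assumes "convex_on UNIV q" and "(q has_derivative (\<lambda>d. d \<bullet> D)) (at x)"
  shows "q x + (z - x) \<bullet> D \<le> q z"
proof -
  have "((\<lambda>y. - q y) has_derivative (\<lambda>d. d \<bullet> (- D))) (at x)"
    using has_derivative_minus[OF assms(2)] by simp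
  then have "q x - q z \<le> (z - x) \<bullet> (- D)"
  proof (rule directional_derivative_ge)
    fix t :: real assume "0 < t" "t < 1"
    then have "q ((1 - t) *\<^sub>R x + t *\<^sub>R z) \<le> (1 - t) * q x + t * q z"
      using assms(1) by (auto simp: convex_on_def)
    then show "t * (q x - q z) \<le> - q (x + t *\<^sub>R (z - x)) - - q x"
      by (simp add: algebra_simps)
  qed
  then show ?thesis by simp
qed

lemma subdiff_differentiable:
  fixes q :: "'a::euclidean_space \<Rightarrow> real"
  assumes "convex_on UNIV q" and "q differentiable (at x)"
  shows "subdiff (\<lambda>z. ereal (q z)) x = {grad q x}"
proof -
  note D = has_derivative_grad[OF assms(2)]
  have "grad q x \<in> subdiff (\<lambda>z. ereal (q z)) x"
    using convex_above_gradient[OF assms(1) D] by (simp add: subdiff_def)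
  then have "{grad q x} \<subseteq> subdiff (\<lambda>z. ereal (q z)) x"
    by simp
  moreover have "subdiff (\<lambda>z. ereal (q z)) x \<subseteq> {grad q x}"
  proof
    fix \<xi> assume \<xi>: "\<xi> \<in> subdiff (\<lambda>z. ereal (q z)) x"
    have ge: "d \<bullet> \<xi> \<le> d \<bullet> grad q x" for d
    proof (rule directional_derivative_ge[OF D])
      fix t :: real
      have "q x + (x + t *\<^sub>R d - x) \<bullet> \<xi> \<le> q (x + t *\<^sub>R d)"
        using \<xi>[unfolded subdiff_def, THEN CollectD, rule_format, of "x + t *\<^sub>R d"] by simp
      then show "t * (d \<bullet> \<xi>) \<le> q (x + t *\<^sub>R d) - q x"
        by simp
    qed
    have "(\<xi> - grad q x) \<bullet> (\<xi> - grad q x) \<le> 0"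
      using ge[of "\<xi> - grad q x"] by (simp add: inner_diff_right)
    then show "\<xi> \<in> {grad q x}"
      using inner_ge_zero[of "\<xi> - grad q x"] by simp
  qed
  ultimately show ?thesis by (rule equalityI[rotated])
qed

text \<open>
  Fermat's rule for a sum of a smooth and a convex function, with the sum rule built in: comparing
  \<open>x\<close> with points on the segment to \<open>z\<close> and using convexity of \<open>g\<close> there bounds the difference
  quotient of \<open>q\<close> from below by a constant that does not depend on the step.
\<close>

lemma minimizer_subgradient:
  fixes q :: "'a::euclidean_space \<Rightarrow> real"
  assumes g: "econvex g" "\<And>z. g z \<noteq> - \<infinity>" "g x \<noteq> \<infinity>"
    and q: "(q has_derivative (\<lambda>d. d \<bullet> D)) (at x)"
    and min: "\<And>z. ereal (q x) + g x - ereal (c \<bullet> x) \<le> ereal (q z) + g z - ereal (c \<bullet> z)"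
  shows "c - D \<in> subdiff g x"
proof -
  obtain gx where gx: "g x = ereal gx"
    using g(2)[of x] g(3) by (cases "g x") auto
  have "g x + ereal ((z - x) \<bullet> (c - D)) \<le> g z" for z
  proof (cases "g z")
    case (real gz)
    have "(z - x) \<bullet> c - (gz - gx) \<le> (z - x) \<bullet> D"
    proof (rule directional_derivative_ge[OF q])
      fix t :: real assume t: "0 < t" "t < 1"
      define w where "w = x + t *\<^sub>R (z - x)"
      have "g ((1 - t) *\<^sub>R x + t *\<^sub>R z) \<le> ereal (1 - t) * g x + ereal t * g z"
        using g(1)[unfolded econvex_def, rule_format, of t x z] t by simp
      moreover have "(1 - t) *\<^sub>R x + t *\<^sub>R z = w"
        by (simp add: w_def algebra_simps)
      ultimately have gw_le: "g w \<le> ereal ((1 - t) * gx + t * gz)"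
        by (simp add: gx real)
      then obtain gw where gw: "g w = ereal gw"
        using g(2)[of w] by (cases "g w") auto
      have "q x + gx - c \<bullet> x \<le> q w + gw - c \<bullet> w"
        using min[of w] by (simp add: gx gw)
      moreover have "gw \<le> (1 - t) * gx + t * gz"
        using gw_le by (simp add: gw)
      moreover have "c \<bullet> w = c \<bullet> x + t * ((z - x) \<bullet> c)"
        by (simp add: w_def inner_add_right inner_commute)
      ultimately show "t * ((z - x) \<bullet> c - (gz - gx)) \<le> q (x + t *\<^sub>R (z - x)) - q x"
        unfolding w_def[symmetric] by (simp add: left_diff_distrib right_diff_distrib)
    qed
    then show ?thesis
      by (simp add: gx real inner_diff_right)
  next
    case MInf
    then show ?thesis using g(2)[of z] by simp
  qed simp
  then show ?thesis
    by (simp add: subdiff_def)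
qed

lemma lipschitz_on_bounded_imp_continuous:
  assumes "lipschitz_on_bounded T"
  shows "continuous_on UNIV T"
proof -
  have "continuous (at z) T" for z
  proof -
    obtain M where "M-lipschitz_on (ball z 1) T"
      using assms unfolding lipschitz_on_bounded_def by (meson bounded_ball)
    then have "continuous_on (ball z 1) T"
      by (rule lipschitz_on_continuous_on)
    then show ?thesis
      by (simp add: continuous_on_eq_continuous_at)
  qed
  then show ?thesis
    by (simp add: continuous_on_eq_continuous_at)
qed

section \<open>Bregman distances\<close>

lemma bregman_three_point:
  "bregman \<phi> x y = bregman \<phi> x z + bregman \<phi> z y + (x - z) \<bullet> (grad \<phi> z - grad \<phi> y)"
  by (simp add: bregman_def inner_diff_left inner_diff_right inner_commute)

lemma convex_bregman_nonneg:
  assumes "convex_on UNIV \<phi>" and "\<And>z. \<phi> differentiable (at z)"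
  shows "0 \<le> bregman \<phi> x y"
  using convex_above_gradient[OF assms(1) has_derivative_grad[OF assms(2)], of y x]
  by (simp add: bregman_def inner_commute)

lemma strongly_convex_bregman:
  assumes "strongly_convex \<phi>" and "\<And>z. \<phi> differentiable (at z)"
  obtains \<rho> where "\<rho> > 0" and "\<And>x y. \<rho> / 2 * (norm (x - y))\<^sup>2 \<le> bregman \<phi> x y"
proof -
  obtain \<rho> where \<rho>: "\<rho> > 0" and cvx: "convex_on UNIV (\<lambda>x. \<phi> x - \<rho> / 2 * (norm x)\<^sup>2)"
    using assms(1) unfolding strongly_convex_def by blast
  have "\<rho> / 2 * (norm (x - y))\<^sup>2 \<le> bregman \<phi> x y" for x y
  proof -
    have "((\<lambda>x. \<phi> x - \<rho> / 2 * (x \<bullet> x)) has_derivative (\<lambda>d. d \<bullet> (grad \<phi> y - \<rho> *\<^sub>R y))) (at y)"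
      by (rule derivative_eq_intros has_derivative_grad assms(2) refl | rule ext)+
        (simp add: inner_diff_right inner_commute)
    from convex_above_gradient[OF cvx[unfolded power2_norm_eq_inner] this, of x]
    have "\<phi> y - \<rho> / 2 * (y \<bullet> y) + (x - y) \<bullet> (grad \<phi> y - \<rho> *\<^sub>R y) \<le> \<phi> x - \<rho> / 2 * (x \<bullet> x)" .
    moreover have "(x - y) \<bullet> (grad \<phi> y - \<rho> *\<^sub>R y) = grad \<phi> y \<bullet> (x - y) - \<rho> * (x \<bullet> y) + \<rho> * (y \<bullet> y)"
      by (simp add: inner_diff_left inner_diff_right inner_commute right_diff_distrib)
    moreover have "\<rho> / 2 * (norm (x - y))\<^sup>2 = \<rho> / 2 * (x \<bullet> x) + \<rho> / 2 * (y \<bullet> y) - \<rho> * (x \<bullet> y)"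
      unfolding power2_norm_eq_inner
      by (simp add: inner_diff_left inner_diff_right inner_commute right_diff_distrib distrib_left)
    ultimately show ?thesis
      unfolding bregman_def by linarith
  qed
  with \<rho> show ?thesis by (rule that)
qed

text \<open>
  The symmetrised distance \<open>bregman \<phi> x y + bregman \<phi> y x\<close> is an inner product of differences, so
  that Cauchy-Schwarz bounds it, and by convexity each summand is at most the sum.
\<close>

lemma convex_bregman_le:
  assumes "convex_on UNIV \<phi>" and "\<And>z. \<phi> differentiable (at z)"
    and "M-lipschitz_on B (grad \<phi>)" and "x \<in> B" "y \<in> B"
  shows "bregman \<phi> x y \<le> M * (norm (x - y))\<^sup>2"
proof -
  have "bregman \<phi> x y + bregman \<phi> y x = (x - y) \<bullet> (grad \<phi> x - grad \<phi> y)"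
    by (simp add: bregman_def inner_diff_left inner_diff_right inner_commute)
  also have "\<dots> \<le> norm (x - y) * norm (grad \<phi> x - grad \<phi> y)"
    by (rule norm_cauchy_schwarz)
  also have "\<dots> \<le> norm (x - y) * (M * norm (x - y))"
    using lipschitz_onD[OF assms(3-5)] by (intro mult_left_mono) (auto simp: dist_norm)
  also have "\<dots> = M * (norm (x - y))\<^sup>2"
    by (simp add: power2_eq_square)
  finally show ?thesis
    using convex_bregman_nonneg[OF assms(1,2), of y x] by linarith
qed

text \<open>
  The map \<open>x \<mapsto> bregman \<phi> y x\<close> contains \<open>grad \<phi> x\<close>, which is only Lipschitz, so it need not
  be differentiable. This estimate is what replaces its derivative: the slope at \<open>(x, y)\<close> in the two
  variables together is at most a multiple of \<open>norm (y - x)\<close>, which tends to \<open>0\<close> along the algorithm.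
\<close>

lemma bregman_perturbation:
  assumes "convex_on UNIV \<phi>" and "\<And>z. \<phi> differentiable (at z)"
    and lip: "M-lipschitz_on B (grad \<phi>)" and B: "x \<in> B" "y \<in> B" "x' \<in> B"
    and r: "norm (x' - x) \<le> r" "norm (y' - y) \<le> r"
  shows "bregman \<phi> y x - (2 * M * norm (y - x) * r + M * r\<^sup>2) \<le> bregman \<phi> y' x'"
proof -
  have M: "M \<ge> 0" using lip lipschitz_on_nonneg by blast
  have r0: "0 \<le> r" using r(1) norm_ge_zero order_trans by blast
  have "bregman \<phi> y' x' - bregman \<phi> y x =
      bregman \<phi> y' y + bregman \<phi> x x' + (grad \<phi> y - grad \<phi> x') \<bullet> (y' - y) + (grad \<phi> x - grad \<phi> x') \<bullet> (y - x)"
    by (simp add: bregman_def inner_diff_left inner_diff_right inner_commute)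
  moreover have "0 \<le> bregman \<phi> y' y" "0 \<le> bregman \<phi> x x'"
    using convex_bregman_nonneg[OF assms(1,2)] by auto
  moreover have "- ((M * (norm (y - x) + r)) * r) \<le> (grad \<phi> y - grad \<phi> x') \<bullet> (y' - y)"
  proof -
    have "norm (grad \<phi> y - grad \<phi> x') \<le> M * norm (y - x')"
      using lipschitz_onD[OF lip B(2,3)] by (simp add: dist_norm)
    also have "\<dots> \<le> M * (norm (y - x) + r)"
      using norm_triangle_ineq4[of "y - x" "x' - x"] r(1) M by (intro mult_left_mono) simp_all
    finally have "norm (grad \<phi> y - grad \<phi> x') * norm (y' - y) \<le> (M * (norm (y - x) + r)) * r"
      using r(2) M r0 by (intro mult_mono) auto
    then show ?thesis
      using Cauchy_Schwarz_ineq2[of "grad \<phi> y - grad \<phi> x'" "y' - y"] by linarith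
  qed
  moreover have "- (M * r * norm (y - x)) \<le> (grad \<phi> x - grad \<phi> x') \<bullet> (y - x)"
  proof -
    have "norm (grad \<phi> x - grad \<phi> x') \<le> M * norm (x' - x)"
      using lipschitz_onD[OF lip B(1,3)] by (simp add: dist_norm norm_minus_commute)
    also have "\<dots> \<le> M * r"
      using r(1) M by (intro mult_left_mono)
    finally have "norm (grad \<phi> x - grad \<phi> x') * norm (y - x) \<le> M * r * norm (y - x)"
      by (rule mult_right_mono) simp
    then show ?thesis
      using Cauchy_Schwarz_ineq2[of "grad \<phi> x - grad \<phi> x'" "y - x"] by linarith
  qed
  moreover have "(M * (norm (y - x) + r)) * r + M * r * norm (y - x) = 2 * M * norm (y - x) * r + M * r\<^sup>2"
    by (simp add: distrib_left distrib_right power2_eq_square)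
  ultimately show ?thesis
    by linarith
qed

section \<open>Lower semicontinuity\<close>

lemma lsc_eventually_less:
  fixes J :: "'a::topological_space \<Rightarrow> ereal"
  assumes "lsc J" and "a < J x"
  shows "\<forall>\<^sub>F z in nhds x. a < J z"
proof -
  have "a < Liminf (at x) J"
    using assms order_less_le_trans unfolding lsc_def by blast
  then show ?thesis
    using less_LiminfD[of a "at x" J] assms(2) by (auto simp: eventually_at_filter elim: eventually_mono)
qed

text \<open>
  In this form, with the values bounded by a convergent sequence, lower semicontinuity serves for the
  existence of minimisers, for the closedness of the subdifferential and for the limit of the
  objective values.
\<close>

lemma lsc_sequentially:
  fixes J :: "'a::topological_space \<Rightarrow> ereal"
  assumes "lsc J" and "X \<longlonglongrightarrow> x" and "B \<longlonglongrightarrow> b" and "\<And>n. J (X n) \<le> B n"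
  shows "J x \<le> b"
proof (rule ccontr)
  assume "\<not> J x \<le> b"
  then obtain a where a: "b < a" "a < J x"
    using dense not_le by metis
  have "\<forall>\<^sub>F n in sequentially. a < J (X n)"
    using lsc_eventually_less[OF assms(1) a(2)] assms(2) by (rule eventually_compose_filterlim)
  moreover have "\<forall>\<^sub>F n in sequentially. B n < a"
    using assms(3) a(1) by (rule order_tendstoD)
  ultimately have "\<forall>\<^sub>F n in sequentially. False"
    by eventually_elim (use assms(4) in \<open>meson leD order_less_trans order_trans\<close>)
  then show False by simp
qed

lemma lscI:
  fixes J :: "'a::topological_space \<Rightarrow> ereal"
  assumes "\<And>x a. a < J x \<Longrightarrow> \<forall>\<^sub>F z in at x. a < J z"
  shows "lsc J"
  unfolding lsc_def le_Liminf_iff using assms by blast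

lemma lsc_add_continuous:
  fixes J :: "'a::topological_space \<Rightarrow> ereal"
  assumes "lsc J" and "continuous_on UNIV q"
  shows "lsc (\<lambda>x. J x + ereal (q x))"
proof (rule lscI)
  fix x a assume a: "a < J x + ereal (q x)"
  then obtain b where b: "a < ereal b" "ereal b < J x + ereal (q x)"
    using ereal_dense2 by blast
  have "ereal (b - q x) < J x"
    using b(2) by (cases "J x") auto
  then obtain c where c: "ereal (b - q x) < ereal c" "ereal c < J x"
    using ereal_dense2 by blast
  have "\<forall>\<^sub>F z in at x. ereal c < J z"
    using lsc_eventually_less[OF assms(1) c(2)] eventually_nhds_conv_at by blast
  moreover have "(q \<longlongrightarrow> q x) (at x)"
    using assms(2) by (simp add: continuous_on_def)
  then have "\<forall>\<^sub>F z in at x. b - c < q z"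
    by (rule order_tendstoD) (use c in auto)
  ultimately show "\<forall>\<^sub>F z in at x. a < J z + ereal (q z)"
  proof eventually_elim
    case (elim z)
    have "ereal b \<le> J z + ereal (q z)"
      using elim by (cases "J z") auto
    then show ?case using b(1) by simp
  qed
qed

lemma lsc_compose_continuous:
  fixes J :: "'b::topological_space \<Rightarrow> ereal" and p :: "'a::topological_space \<Rightarrow> 'b"
  assumes "lsc J" and "continuous_on UNIV p"
  shows "lsc (\<lambda>x. J (p x))"
proof (rule lscI)
  fix x a assume "a < J (p x)"
  then have "\<forall>\<^sub>F w in nhds (p x). a < J w"
    using lsc_eventually_less[OF assms(1)] by blast
  moreover have "filterlim p (nhds (p x)) (at x)"
    using assms(2) by (simp add: continuous_on_def)
  ultimately show "\<forall>\<^sub>F z in at x. a < J (p z)"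
    by (rule eventually_compose_filterlim)
qed

lemma lsc_attains_min:
  fixes J :: "'a::metric_space \<Rightarrow> ereal"
  assumes "lsc J" and "compact K" and "K \<noteq> {}"
  obtains x where "x \<in> K" and "\<And>z. z \<in> K \<Longrightarrow> J x \<le> J z"
proof -
  obtain B where B: "\<And>n. B n \<in> J ` K" "B \<longlonglongrightarrow> Inf (J ` K)"
    using Inf_as_limit[of "J ` K"] assms(3) by blast
  from B(1) have "\<forall>n. \<exists>z. z \<in> K \<and> B n = J z"
    by blast
  then obtain X where X: "\<And>n. X n \<in> K" "\<And>n. B n = J (X n)"
    using choice[of "\<lambda>n z. z \<in> K \<and> B n = J z"] by blast
  obtain x r where x: "x \<in> K" "strict_mono (r :: nat \<Rightarrow> nat)" "(X \<circ> r) \<longlonglongrightarrow> x"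
    using assms(2) X(1) unfolding compact_def by blast
  have "J x \<le> Inf (J ` K)"
    using lsc_sequentially[OF assms(1) x(3) LIMSEQ_subseq_LIMSEQ[OF B(2) x(2)]] X(2) by auto
  then show ?thesis
    using that x(1) by (meson INF_lower order_trans)
qed

lemma subdiff_closed:
  fixes g :: "'a::euclidean_space \<Rightarrow> ereal"
  assumes "lsc g" and "X \<longlonglongrightarrow> x" and "V \<longlonglongrightarrow> v" and "\<And>n. V n \<in> subdiff g (X n)"
  shows "v \<in> subdiff g x"
proof -
  have "g x + ereal ((z - x) \<bullet> v) \<le> g z" for z
  proof -
    have "(\<lambda>n. ereal ((z - X n) \<bullet> V n)) \<longlonglongrightarrow> ereal ((z - x) \<bullet> v)"
      by (intro tendsto_intros assms)
    then have "(\<lambda>n. g z - ereal ((z - X n) \<bullet> V n)) \<longlonglongrightarrow> g z - ereal ((z - x) \<bullet> v)"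
      by (cases "g z") (auto intro!: tendsto_diff)
    moreover have "g (X n) \<le> g z - ereal ((z - X n) \<bullet> V n)" for n
      using assms(4)[of n] by (simp add: subdiff_def ereal_le_minus)
    ultimately have "g x \<le> g z - ereal ((z - x) \<bullet> v)"
      using lsc_sequentially[OF assms(1,2)] by blast
    then show ?thesis
      by (simp add: ereal_le_minus)
  qed
  then show ?thesis
    by (simp add: subdiff_def)
qed

section \<open>Limiting subgradients by proximal penalisation\<close>

text \<open>
  A quadratic error contributes \<open>C * norm (z - x)\<close> to the difference quotient, which vanishes in the
  limit.
\<close>

lemma proximal_imp_frechet_subgradient:
  fixes J :: "'a::euclidean_space \<Rightarrow> ereal"
  assumes "\<bar>J x\<bar> \<noteq> \<infinity>" and "e > 0"
    and minorant: "\<And>z. dist z x < e \<Longrightarrow> J x + ereal (u \<bullet> (z - x) - C * (norm (z - x))\<^sup>2) \<le> J z"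
  shows "u \<in> frechet_subdiff J x"
proof -
  obtain j where j: "J x = ereal j"
    using assms(1) by (cases "J x") auto
  have "((\<lambda>z. - C * norm (z - x)) \<longlongrightarrow> - C * norm (x - x)) (at x)"
    by (intro tendsto_intros)
  then have "((\<lambda>z. ereal (- C * norm (z - x))) \<longlongrightarrow> 0) (at x)"
    by (simp add: zero_ereal_def)
  then have "0 = Liminf (at x) (\<lambda>z. ereal (- C * norm (z - x)))"
    by (intro lim_imp_Liminf[symmetric]) auto
  also have "\<dots> \<le> Liminf (at x) (\<lambda>z. (J z - J x - ereal (u \<bullet> (z - x))) / ereal (norm (z - x)))"
  proof (rule Liminf_mono)
    have "\<forall>\<^sub>F z in at x. z \<noteq> x \<and> dist z x < e"
      using assms(2) unfolding eventually_at by blast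
    then show "\<forall>\<^sub>F z in at x. ereal (- C * norm (z - x))
        \<le> (J z - J x - ereal (u \<bullet> (z - x))) / ereal (norm (z - x))"
    proof eventually_elim
      case (elim z)
      then have pos: "0 < norm (z - x)" by simp
      have "ereal (j + (u \<bullet> (z - x) - C * (norm (z - x))\<^sup>2)) \<le> J z"
        using minorant[of z] elim by (simp add: j)
      then have "ereal (- C * norm (z - x) * norm (z - x)) \<le> J z - J x - ereal (u \<bullet> (z - x))"
        by (cases "J z") (auto simp: j power2_eq_square mult.assoc)
      then show ?case
        using pos by (simp add: ereal_le_divide_pos mult.commute)
    qed
  qed
  finally show ?thesis
    by (simp add: frechet_subdiff_def j)
qed

text \<open>
  A sum rule would only bound the subdifferential from above and could not show that it is nonempty;
  a proximal penalty produces an element. Minimise \<open>J\<close> plus the penalty \<open>(C + m) * (norm (z - u))\<^sup>2\<close> over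
  the ball. At the minimiser \<open>Z\<close> the penalty has to pay for the possible gain, which forces
  \<open>m * norm (Z - u) \<le> \<kappa>\<close>, so minus the gradient of the penalty is a proximal subgradient of \<open>J\<close> at
  \<open>Z\<close> of norm at most \<open>2 * (C + m) * norm (Z - u)\<close>, where the part with \<open>m\<close> is at most
  \<open>2 * \<kappa>\<close> and the part with \<open>C\<close> vanishes. Let \<open>m\<close> tend to infinity.
\<close>

lemma limiting_subgradient_of_linear_minorant:
  fixes J :: "'a::euclidean_space \<Rightarrow> ereal"
  assumes "lsc J" and fin: "\<bar>J u\<bar> \<noteq> \<infinity>" and "r > 0" and "\<kappa> \<ge> 0" and "C \<ge> 0"
    and minorant: "\<And>z. norm (z - u) \<le> r \<Longrightarrow> J u - ereal (\<kappa> * norm (z - u) + C * (norm (z - u))\<^sup>2) \<le> J z"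
  obtains s where "s \<in> limiting_subdiff J u" and "norm s \<le> 2 * \<kappa>"
proof -
  obtain j where j: "J u = ereal j"
    using fin by (cases "J u") auto
  \<comment> \<open>penalties so large that the minimiser lies inside the ball, where \<open>norm (Z - u) \<le> \<kappa> / m < r\<close>\<close>
  obtain n0 :: nat where n0: "\<kappa> / r < real n0"
    using reals_Archimedean2 by blast
  define m where "m n = real (n0 + Suc n)" for n
  have m: "0 < m n" "\<kappa> / m n < r" for n
  proof -
    show "0 < m n" by (simp add: m_def)
    have "\<kappa> / r < m n" using n0 by (simp add: m_def)
    then show "\<kappa> / m n < r"
      using \<open>0 < m n\<close> \<open>r > 0\<close> by (simp add: field_simps)
  qed
  have m_lim: "(\<lambda>n. \<kappa> / m n) \<longlonglongrightarrow> 0"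
    using LIMSEQ_ignore_initial_segment[OF lim_const_over_n[of \<kappa>], of "Suc n0"]
    by (simp add: m_def add.commute)
  define P where "P n z = J z + ereal ((C + m n) * (norm (z - u))\<^sup>2)" for n z
  have "\<exists>z. norm (z - u) \<le> r \<and> (\<forall>w. norm (w - u) \<le> r \<longrightarrow> P n z \<le> P n w)" for n
  proof -
    have "lsc (P n)"
      unfolding P_def by (intro lsc_add_continuous assms(1) continuous_intros)
    then obtain z where "z \<in> cball u r" "\<And>w. w \<in> cball u r \<Longrightarrow> P n z \<le> P n w"
      using lsc_attains_min[of "P n" "cball u r"] \<open>r > 0\<close> by (metis cball_eq_empty compact_cball not_less_iff_gr_or_eq)
    then show ?thesis
      by (auto simp: dist_norm norm_minus_commute)
  qed
  then obtain Z where Z: "\<And>n. norm (Z n - u) \<le> r"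
    and Z_min: "\<And>n w. norm (w - u) \<le> r \<Longrightarrow> P n (Z n) \<le> P n w"
    by metis
  define d where "d n = norm (Z n - u)" for n
  have Z_le: "J (Z n) + ereal ((C + m n) * (d n)\<^sup>2) \<le> ereal j" for n
    using Z_min[of u n] \<open>r > 0\<close> by (simp add: P_def j d_def zero_ereal_def[symmetric])
  have Z_ge: "ereal (j - (\<kappa> * d n + C * (d n)\<^sup>2)) \<le> J (Z n)" for n
    using minorant[OF Z[of n]] by (simp add: j d_def)
  have Z_fin: "\<bar>J (Z n)\<bar> \<noteq> \<infinity>" for n
    using Z_le[of n] Z_ge[of n] by (cases "J (Z n)") auto
  have md: "m n * d n \<le> \<kappa>" for n
  proof (cases "d n = 0")
    case False
    then have "0 < d n" by (simp add: d_def)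
    moreover have "m n * (d n)\<^sup>2 \<le> \<kappa> * d n"
      using Z_le[of n] Z_ge[of n] by (cases "J (Z n)") (auto simp: algebra_simps)
    ultimately show ?thesis
      by (simp add: power2_eq_square mult.assoc[symmetric])
  qed (use \<open>\<kappa> \<ge> 0\<close> in simp)
  have d_le: "d n \<le> \<kappa> / m n" for n
    using md[of n] m(1)[of n] by (simp add: field_simps)
  have "d \<longlonglongrightarrow> 0"
    by (rule real_tendsto_sandwich[OF _ _ tendsto_const m_lim]) (auto simp: d_le, simp add: d_def)
  then have Z_lim: "Z \<longlonglongrightarrow> u"
    unfolding d_def by (simp add: LIM_zero_iff tendsto_norm_zero_iff)
  have JZ_lim: "(\<lambda>n. J (Z n)) \<longlonglongrightarrow> J u"
  proof (rule tendsto_sandwich)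
    have "(\<lambda>n. j - (\<kappa> * d n + C * (d n)\<^sup>2)) \<longlonglongrightarrow> j - (\<kappa> * 0 + C * 0\<^sup>2)"
      by (intro tendsto_intros \<open>d \<longlonglongrightarrow> 0\<close>)
    then show "(\<lambda>n. ereal (j - (\<kappa> * d n + C * (d n)\<^sup>2))) \<longlonglongrightarrow> J u"
      by (simp add: j)
    show "\<forall>\<^sub>F n in sequentially. J (Z n) \<le> ereal j"
    proof (rule always_eventually, rule allI)
      fix n
      have "0 \<le> (C + m n) * (d n)\<^sup>2"
        using m(1)[of n] \<open>C \<ge> 0\<close> by simp
      then show "J (Z n) \<le> ereal j"
        using Z_le[of n] by (cases "J (Z n)") auto
    qed
  qed (use Z_ge j in auto)
  define S where "S n = - ((2 * (C + m n)) *\<^sub>R (Z n - u))" for n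
  have S_frechet: "S n \<in> frechet_subdiff J (Z n)" for n
  proof (rule proximal_imp_frechet_subgradient[where e = "r - d n" and C = "C + m n"])
    show "\<bar>J (Z n)\<bar> \<noteq> \<infinity>" by (fact Z_fin)
    show "0 < r - d n"
      using d_le[of n] m(2)[of n] by simp
    fix z assume "dist z (Z n) < r - d n"
    then have "norm (z - u) \<le> r"
      using norm_triangle_ineq[of "z - Z n" "Z n - u"] by (simp add: dist_norm d_def)
    then have le: "J (Z n) + ereal ((C + m n) * (norm (Z n - u))\<^sup>2) \<le> J z + ereal ((C + m n) * (norm (z - u))\<^sup>2)"
      using Z_min[of z n] by (simp add: P_def)
    have "(norm (z - u))\<^sup>2 = (norm (Z n - u))\<^sup>2 + 2 * ((Z n - u) \<bullet> (z - Z n)) + (norm (z - Z n))\<^sup>2"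
      unfolding power2_norm_eq_inner by (simp add: inner_diff_left inner_diff_right inner_commute)
    then have "(C + m n) * (norm (z - u))\<^sup>2 = (C + m n) * (norm (Z n - u))\<^sup>2 - S n \<bullet> (z - Z n) + (C + m n) * (norm (z - Z n))\<^sup>2"
      by (simp add: S_def distrib_left)
    with le show "J (Z n) + ereal (S n \<bullet> (z - Z n) - (C + m n) * (norm (z - Z n))\<^sup>2) \<le> J z"
      using Z_fin[of n] by (cases "J (Z n)"; cases "J z") auto
  qed
  have S_norm: "norm (S n) \<le> 2 * \<kappa> + 2 * C * d n" for n
  proof -
    have "norm (S n) = 2 * (C + m n) * d n"
      using m(1)[of n] \<open>C \<ge> 0\<close> by (simp add: S_def d_def)
    then show ?thesis
      using md[of n] by (simp add: algebra_simps)
  qed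
  have "bounded (range S)"
  proof (rule boundedI)
    fix s assume "s \<in> range S"
    then obtain n where n: "s = S n" by blast
    have "2 * C * d n \<le> 2 * C * r"
      using Z[of n] \<open>C \<ge> 0\<close> by (intro mult_left_mono) (auto simp: d_def)
    then show "norm s \<le> 2 * \<kappa> + 2 * C * r"
      using S_norm[of n] n by simp
  qed
  then obtain s q where s: "strict_mono (q :: nat \<Rightarrow> nat)" "(S \<circ> q) \<longlonglongrightarrow> s"
    using bounded_imp_convergent_subsequence by blast
  show ?thesis
  proof (rule that[of s])
    show "s \<in> limiting_subdiff J u"
      unfolding limiting_subdiff_def mem_Collect_eq
    proof (rule conjI, simp add: j, rule exI[of _ "Z \<circ> q"], rule exI[of _ "S \<circ> q"], intro conjI)
      show "(Z \<circ> q) \<longlonglongrightarrow> u"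
        using Z_lim s(1) by (rule LIMSEQ_subseq_LIMSEQ)
      show "(\<lambda>k. J ((Z \<circ> q) k)) \<longlonglongrightarrow> J u"
        using LIMSEQ_subseq_LIMSEQ[OF JZ_lim s(1)] by (simp add: o_def)
    qed (use s S_frechet in auto)
    have "(\<lambda>n. 2 * \<kappa> + 2 * C * d (q n)) \<longlonglongrightarrow> 2 * \<kappa> + 2 * C * 0"
      using LIMSEQ_subseq_LIMSEQ[OF \<open>d \<longlonglongrightarrow> 0\<close> s(1)] by (intro tendsto_intros) (simp add: o_def)
    moreover have "(\<lambda>n. norm (S (q n))) \<longlonglongrightarrow> norm s"
      using tendsto_norm[OF s(2)] by (simp add: o_def)
    ultimately show "norm s \<le> 2 * \<kappa>"
      using S_norm by (intro LIMSEQ_le[of "\<lambda>n. norm (S (q n))" _ "\<lambda>n. 2 * \<kappa> + 2 * C * d (q n)"]) auto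
  qed
qed

section \<open>Convergence under the KL property\<close>

lemma desingularizing_above_tangent:
  assumes "desingularizing \<eta> \<psi>" and t: "0 \<le> t" "0 < s" and "ereal s < \<eta>" "ereal t < \<eta>"
  shows "deriv \<psi> s * (s - t) \<le> \<psi> s - \<psi> t"
proof -
  define I where "I = {t. 0 \<le> t \<and> ereal t < \<eta>}"
  define U where "U = {t. 0 < t \<and> ereal t < \<eta>}"
  have "convex_on I (\<lambda>t. - \<psi> t)"
    using assms(1) unfolding desingularizing_def I_def concave_on_def by blast
  moreover have "connected I"
    unfolding I_def
    by (rule is_interval_connected) (auto simp: is_interval_1 intro: order_le_less_trans[of "ereal _" "ereal _"])
  moreover have "s \<in> interior I"
  proof (rule interiorI)
    have "U = {0<..} \<inter> ereal -` {..<\<eta>}"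
      by (auto simp: U_def)
    moreover have "open (ereal -` {..<\<eta>})"
      by (rule open_ereal_vimage) simp
    ultimately show "open U" by (simp add: open_Int)
  qed (use assms in \<open>auto simp: U_def I_def\<close>)
  moreover have "t \<in> I"
    using assms by (simp add: I_def)
  moreover have "((\<lambda>t. - \<psi> t) has_real_derivative - deriv \<psi> s) (at s within I)"
  proof -
    have "\<psi> differentiable (at s)"
      using assms unfolding desingularizing_def by blast
    then have "(\<psi> has_real_derivative deriv \<psi> s) (at s)"
      by (simp add: DERIV_deriv_iff_real_differentiable)
    then show ?thesis
      by (rule DERIV_minus[OF has_field_derivative_at_within])
  qed
  ultimately have "- deriv \<psi> s * (t - s) \<le> - \<psi> t - - \<psi> s"
    by (rule convex_on_imp_above_tangent)
  then show ?thesis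
    by (simp add: algebra_simps)
qed

lemma KL_slope:
  assumes V: "u \<in> V" "J u0 < J u" "J u < J u0 + \<eta>"
    and KL: "\<forall>u\<in>V. J u0 < J u \<and> J u < J u0 + \<eta> \<longrightarrow>
        ereal (deriv \<psi> (real_of_ereal (J u - J u0))) * dist0 (limiting_subdiff J u) \<ge> 1"
    and J: "J u0 = ereal \<zeta>" "J u = ereal (\<zeta> + t)"
    and \<psi>: "0 < deriv \<psi> t" and s: "s \<in> limiting_subdiff J u" "norm s \<le> \<kappa>"
  shows "1 \<le> deriv \<psi> t * \<kappa>"
proof -
  have "1 \<le> ereal (deriv \<psi> t) * dist0 (limiting_subdiff J u)"
    using KL[rule_format, OF V(1) conjI[OF V(2,3)]] J by simp
  also have "dist0 (limiting_subdiff J u) \<le> ereal \<kappa>"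
    unfolding dist0_def using s by (intro INF_lower2[of s]) auto
  then have "ereal (deriv \<psi> t) * dist0 (limiting_subdiff J u) \<le> ereal (deriv \<psi> t) * ereal \<kappa>"
    using \<psi> by (intro ereal_mult_left_mono) auto
  finally show ?thesis
    by (simp add: one_ereal_def)
qed

text \<open>
  Here \<open>D\<close> is the length of a step, \<open>\<sigma>\<close> the sum of the two preceding lengths, \<open>h\<close> the decrease of
  the merit function and \<open>Q\<close> the decrease of the desingularised value. The hypotheses give
  \<open>D\<^sup>2 \<le> \<sigma> * (C / a * Q)\<close>, and the weighted inequality between the means splits the product. The
  weight is chosen so that \<open>\<sigma>\<close> enters with the factor \<open>1 / 4\<close>: this is half of the average of
  the two preceding lengths, so the lengths contract up to the decrease \<open>Q\<close>, whose sum telescopes.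
\<close>

lemma KL_descent_step:
  fixes D \<sigma> Q :: real
  assumes "a > 0" and "C \<ge> 0" "\<sigma> \<ge> 0" "D \<ge> 0"
    and slope: "1 \<le> \<psi>' * (C * \<sigma>)" and descent: "a * D\<^sup>2 \<le> h" and concave: "\<psi>' * h \<le> Q"
  shows "D \<le> \<sigma> / 4 + C / a * Q"
proof -
  have h: "0 \<le> h" using descent \<open>a > 0\<close> by (meson less_imp_le mult_nonneg_nonneg order_trans zero_le_power2)
  have "a * D\<^sup>2 \<le> \<psi>' * (C * \<sigma>) * h"
    using mult_right_mono[OF slope h] descent by simp
  also have "\<dots> = C * \<sigma> * (\<psi>' * h)" by simp
  also have "\<dots> \<le> C * \<sigma> * Q"
    using concave assms by (intro mult_left_mono) auto
  finally have "D\<^sup>2 \<le> \<sigma> * (C / a * Q)"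
    using \<open>a > 0\<close> by (simp add: field_simps)
  also have "\<dots> \<le> (\<sigma> / 4 + C / a * Q)\<^sup>2"
  proof -
    have "0 \<le> (\<sigma> / 4 - C / a * Q)\<^sup>2" by simp
    then show ?thesis by (simp add: power2_eq_square algebra_simps)
  qed
  finally have "D\<^sup>2 \<le> (\<sigma> / 4 + C / a * Q)\<^sup>2" .
  moreover have "0 \<le> Q"
  proof -
    have "0 \<le> \<psi>'"
    proof (rule ccontr)
      assume "\<not> 0 \<le> \<psi>'"
      then have "\<psi>' * (C * \<sigma>) \<le> 0"
        using assms(2,3) by (intro mult_nonpos_nonneg) auto
      then show False using slope by linarith
    qed
    then have "0 \<le> \<psi>' * h" using h by simp
    then show ?thesis using concave by linarith
  qed
  ultimately show ?thesis
    using assms(1-3) by (intro power2_le_imp_le[OF _ add_nonneg_nonneg]) simp_all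
qed

lemma sufficient_decrease_imp_vanishing:
  fixes d H :: "nat \<Rightarrow> real"
  assumes a: "a > 0" and decrease: "\<And>k. a * (d (Suc k))\<^sup>2 \<le> H k - H (Suc k)" and "H \<longlonglongrightarrow> \<zeta>"
  shows "(\<lambda>k. d (Suc k)) \<longlonglongrightarrow> 0"
proof -
  have "(\<lambda>k. (H k - H (Suc k)) / a) \<longlonglongrightarrow> (\<zeta> - \<zeta>) / a"
    by (intro tendsto_intros assms LIMSEQ_Suc) (use a in simp)
  then have lim: "(\<lambda>k. (H k - H (Suc k)) / a) \<longlonglongrightarrow> 0" by simp
  have "(d (Suc k))\<^sup>2 \<le> (H k - H (Suc k)) / a" for k
    using decrease[of k] a by (simp add: field_simps)
  then have "(\<lambda>k. (d (Suc k))\<^sup>2) \<longlonglongrightarrow> 0"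
    by (intro tendsto_sandwich[OF _ _ tendsto_const lim] always_eventually allI) simp_all
  then have "(\<lambda>k. sqrt ((d (Suc k))\<^sup>2)) \<longlonglongrightarrow> sqrt 0"
    by (rule tendsto_real_sqrt)
  then show ?thesis
    by (simp add: tendsto_rabs_zero_iff)
qed

text \<open>
  The KL inequality is needed at a single cluster point only. As long as the iterates stay in its
  neighbourhood, every step satisfies the bound of \<open>KL_descent_step\<close>, which says that
  \<open>E k = norm (x (k + 2) - xs) + d (k + 1) + d k / 2 + 2 * q (k + 1)\<close> does not increase: a new step of
  length \<open>d (k + 2)\<close> moves the iterate away from \<open>xs\<close> by at most that length, and the other terms drop
  by at least as much. Since \<open>E k\<close> also bounds the distances of the two current iterates from \<open>xs\<close>, a
  small value keeps them in the neighbourhood, so smallness of \<open>E\<close> perpetuates itself. Along the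
  subsequence that converges to \<open>xs\<close> all four terms of \<open>E\<close> tend to \<open>0\<close>, hence so does \<open>E\<close>, and the
  whole sequence converges.
\<close>

lemma KL_descent_convergence:
  fixes J :: "'a::euclidean_space \<times> 'a \<Rightarrow> ereal" and x :: "nat \<Rightarrow> 'a"
  assumes KL: "KL_at J (xs, xs)" and J_lim: "J (xs, xs) = ereal \<zeta>"
    and J_H: "\<And>k. J (x (Suc k), x k) = ereal (H k)" and H_lim: "H \<longlonglongrightarrow> \<zeta>"
    and a: "a > 0" and descent: "\<And>k. a * (norm (x (Suc (Suc k)) - x (Suc k)))\<^sup>2 \<le> H k - H (Suc k)"
    and C: "C \<ge> 0" and slope: "\<And>k. \<exists>s\<in>limiting_subdiff J (x (Suc (Suc k)), x (Suc k)).
        norm s \<le> C * (norm (x (Suc (Suc k)) - x (Suc k)) + norm (x (Suc k) - x k))"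
    and cluster: "strict_mono r" "(x \<circ> r) \<longlonglongrightarrow> xs"
  shows "x \<longlonglongrightarrow> xs"
proof -
  obtain \<eta> V \<psi> where \<eta>: "\<eta> > 0" and V: "open V" "(xs, xs) \<in> V" and \<psi>: "desingularizing \<eta> \<psi>"
    and KL_ineq: "\<forall>u\<in>V. J (xs, xs) < J u \<and> J u < J (xs, xs) + \<eta> \<longrightarrow>
      ereal (deriv \<psi> (real_of_ereal (J u - J (xs, xs)))) * dist0 (limiting_subdiff J u) \<ge> 1"
    using KL unfolding KL_at_def by (elim exE conjE) (rule that)
  obtain A B where AB: "open A" "open B" "xs \<in> A" "xs \<in> B" "A \<times> B \<subseteq> V"
    by (rule open_prod_elim[OF V]) (auto simp: subset_iff)
  then have "open (A \<inter> B)" "xs \<in> A \<inter> B" by auto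
  then obtain \<epsilon>0 where \<epsilon>0: "\<epsilon>0 > 0" "ball xs \<epsilon>0 \<subseteq> A \<inter> B"
    using open_contains_ball by blast
  have in_V: "(p, q) \<in> V" if "norm (p - xs) < \<epsilon>0" "norm (q - xs) < \<epsilon>0" for p q
  proof -
    have "p \<in> ball xs \<epsilon>0" "q \<in> ball xs \<epsilon>0"
      using that by (auto simp: dist_norm norm_minus_commute)
    then show ?thesis using \<epsilon>0(2) AB(5) by blast
  qed
  define d where "d k = norm (x (Suc k) - x k)" for k
  have descent_d: "a * (d (Suc k))\<^sup>2 \<le> H k - H (Suc k)" for k
    using descent[of k] by (simp add: d_def)
  have "decseq H"
  proof (rule decseq_SucI)
    fix k
    have "0 \<le> a * (d (Suc k))\<^sup>2" using a by simp
    then show "H (Suc k) \<le> H k" using descent_d[of k] by linarith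
  qed
  then have H_ge: "\<zeta> \<le> H k" for k
    using H_lim decseq_ge by blast
  define I where "I = {t. 0 \<le> t \<and> ereal t < \<eta>}"
  have H_lim0: "(\<lambda>k. H k - \<zeta>) \<longlonglongrightarrow> 0"
    using H_lim by (simp add: LIM_zero)
  have H_ev: "\<forall>\<^sub>F k in sequentially. H k - \<zeta> \<in> I"
  proof -
    have "(\<lambda>k. ereal (H k - \<zeta>)) \<longlonglongrightarrow> ereal 0"
      using H_lim0 by (simp only: lim_ereal)
    then have "\<forall>\<^sub>F k in sequentially. ereal (H k - \<zeta>) < \<eta>"
      by (rule order_tendstoD) (use \<eta> in \<open>simp add: zero_ereal_def\<close>)
    then show ?thesis
      by eventually_elim (use H_ge in \<open>simp add: I_def\<close>)
  qed
  define q where "q k = C / a * \<psi> (H k - \<zeta>)" for k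
  have \<psi>0: "\<psi> 0 = 0" and \<psi>_nonneg: "\<And>t. t \<in> I \<Longrightarrow> 0 \<le> \<psi> t"
    and \<psi>_pos: "\<And>t. t \<in> I \<Longrightarrow> 0 < t \<Longrightarrow> 0 < deriv \<psi> t" and \<psi>_cont: "continuous_on I \<psi>"
    using \<psi> unfolding desingularizing_def I_def by auto
  have q_lim: "q \<longlonglongrightarrow> 0"
  proof -
    have "(\<lambda>k. \<psi> (H k - \<zeta>)) \<longlonglongrightarrow> \<psi> 0"
      using \<psi>_cont H_lim0 _ H_ev
      by (rule continuous_on_tendsto_compose) (use \<eta> in \<open>simp add: I_def zero_ereal_def[symmetric]\<close>)
    then have "(\<lambda>k. C / a * \<psi> (H k - \<zeta>)) \<longlonglongrightarrow> C / a * \<psi> 0"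
      by (rule tendsto_mult_left)
    then show ?thesis
      by (simp add: q_def[abs_def] \<psi>0)
  qed
  have q_nonneg: "0 \<le> q k" if "H k - \<zeta> \<in> I" for k
    using \<psi>_nonneg[OF that] a C by (simp add: q_def)
  have d_lim: "d \<longlonglongrightarrow> 0"
    using sufficient_decrease_imp_vanishing[OF a descent_d H_lim] by (simp add: filterlim_sequentially_Suc)
  have step: "d (Suc (Suc k)) \<le> (d (Suc k) + d k) / 4 + (q (Suc k) - q (Suc (Suc k)))"
    if u: "(x (Suc (Suc k)), x (Suc k)) \<in> V" and t: "H (Suc k) - \<zeta> \<in> I" for k
    \<comment> \<open>the KL inequality says nothing where the limit value is attained, but there the sequence has stopped\<close>
  proof (cases "H (Suc k) = \<zeta>")
    case True
    then have "H (Suc (Suc k)) = \<zeta>"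
      using \<open>decseq H\<close> H_ge by (metis decseq_SucD order_antisym)
    then have "a * (d (Suc (Suc k)))\<^sup>2 \<le> 0"
      using descent_d[of "Suc k"] True by simp
    then have "d (Suc (Suc k)) = 0"
      using a by (simp add: mult_le_0_iff)
    then show ?thesis
      using True \<open>H (Suc (Suc k)) = \<zeta>\<close> by (simp add: q_def d_def)
  next
    case False
    define t where "t = H (Suc k) - \<zeta>"
    define t' where "t' = H (Suc (Suc k)) - \<zeta>"
    have "0 < t" "0 \<le> t'" "t' \<le> t"
      using False H_ge[of "Suc k"] H_ge[of "Suc (Suc k)"] decseq_SucD[OF \<open>decseq H\<close>, of "Suc k"]
      by (auto simp: t_def t'_def)
    have t_I: "ereal t < \<eta>" using t by (simp add: t_def I_def)
    then have t'_I: "ereal t' < \<eta>" using \<open>t' \<le> t\<close> by (metis ereal_less_eq(3) order_le_less_trans)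
    have \<psi>'_pos: "0 < deriv \<psi> t"
      using \<psi>_pos[OF t] \<open>0 < t\<close> by (simp add: t_def)
    obtain s where s: "s \<in> limiting_subdiff J (x (Suc (Suc k)), x (Suc k))" "norm s \<le> C * (d (Suc k) + d k)"
      using slope[of k] by (auto simp: d_def)
    have Ju: "J (x (Suc (Suc k)), x (Suc k)) = ereal (\<zeta> + t)"
      by (simp add: J_H t_def)
    have "1 \<le> deriv \<psi> t * (C * (d (Suc k) + d k))"
    proof (rule KL_slope[OF u _ _ KL_ineq J_lim Ju \<psi>'_pos s])
      show "J (xs, xs) < J (x (Suc (Suc k)), x (Suc k))"
        using \<open>0 < t\<close> by (simp add: J_lim Ju)
      show "J (x (Suc (Suc k)), x (Suc k)) < J (xs, xs) + \<eta>"
        using t_I by (cases \<eta>) (auto simp: J_lim Ju)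
    qed
    moreover have "a * (d (Suc (Suc k)))\<^sup>2 \<le> t - t'"
      using descent_d[of "Suc k"] by (simp add: t_def t'_def)
    moreover have "deriv \<psi> t * (t - t') \<le> \<psi> t - \<psi> t'"
      using \<psi> \<open>0 \<le> t'\<close> \<open>0 < t\<close> t_I t'_I by (rule desingularizing_above_tangent)
    ultimately have "d (Suc (Suc k)) \<le> (d (Suc k) + d k) / 4 + C / a * (\<psi> t - \<psi> t')"
      using a C by (intro KL_descent_step[where \<psi>' = "deriv \<psi> t" and h = "t - t'"]) (auto simp: d_def)
    then show ?thesis
      by (simp add: q_def t_def t'_def right_diff_distrib)
  qed
  define E where "E k = norm (x (Suc (Suc k)) - xs) + d (Suc k) + d k / 2 + 2 * q (Suc k)" for k
  obtain N0 where N0: "\<And>k. k \<ge> N0 \<Longrightarrow> H k - \<zeta> \<in> I"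
    using H_ev unfolding eventually_sequentially by blast
  have E_dec: "E (Suc k) \<le> E k" if "k \<ge> N0" "E k < \<epsilon>0" for k
  proof -
    have q: "0 \<le> q (Suc k)" "0 \<le> d k" "0 \<le> d (Suc k)"
      using q_nonneg N0 that(1) by (auto simp: d_def)
    have "norm (x (Suc (Suc k)) - xs) < \<epsilon>0"
      using that(2) q norm_ge_zero[of "x (Suc (Suc k)) - xs"] by (simp add: E_def)
    moreover have "norm (x (Suc k) - xs) < \<epsilon>0"
    proof -
      have "norm (x (Suc k) - xs) \<le> norm (x (Suc (Suc k)) - xs) + d (Suc k)"
        using norm_triangle_ineq4[of "x (Suc (Suc k)) - xs" "x (Suc (Suc k)) - x (Suc k)"] by (simp add: d_def)
      then show ?thesis
        using that(2) q by (simp add: E_def)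
    qed
    ultimately have "d (Suc (Suc k)) \<le> (d (Suc k) + d k) / 4 + (q (Suc k) - q (Suc (Suc k)))"
      using step in_V N0 that(1) by simp
    moreover have "norm (x (Suc (Suc (Suc k))) - xs) \<le> norm (x (Suc (Suc k)) - xs) + d (Suc (Suc k))"
      using norm_triangle_ineq[of "x (Suc (Suc k)) - xs" "x (Suc (Suc (Suc k))) - x (Suc (Suc k))"] by (simp add: d_def)
    ultimately show ?thesis
      unfolding E_def by argo
  qed
  show ?thesis
  proof (rule LIMSEQ_I)
    fix e :: real assume "e > 0"
    define \<epsilon> where "\<epsilon> = min e \<epsilon>0"
    have \<epsilon>: "\<epsilon> > 0" "\<epsilon> \<le> e" "\<epsilon> \<le> \<epsilon>0"
      using \<open>e > 0\<close> \<epsilon>0 by (auto simp: \<epsilon>_def)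
    have "\<forall>\<^sub>F k in sequentially. d k < \<epsilon> / 8" "\<forall>\<^sub>F k in sequentially. q k < \<epsilon> / 8"
      using order_tendstoD(2)[OF d_lim, of "\<epsilon> / 8"] order_tendstoD(2)[OF q_lim, of "\<epsilon> / 8"] \<epsilon> by auto
    then obtain N1 where N1: "\<And>k. k \<ge> N1 \<Longrightarrow> d k < \<epsilon> / 8" "\<And>k. k \<ge> N1 \<Longrightarrow> q k < \<epsilon> / 8"
      unfolding eventually_sequentially by (metis linorder_le_cases order_trans)
    obtain N2 where N2: "\<And>j. j \<ge> N2 \<Longrightarrow> norm ((x \<circ> r) j - xs) < \<epsilon> / 4"
      using LIMSEQ_D[OF cluster(2), of "\<epsilon> / 4"] \<epsilon> by auto
    define j where "j = N0 + N1 + N2 + 2"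
    have "j \<le> r j" using seq_suble[OF cluster(1)] .
    define k where "k = r j - 2"
    have k: "Suc (Suc k) = r j" "N0 \<le> k" "N1 \<le> k"
      using \<open>j \<le> r j\<close> by (auto simp: k_def j_def)
    have "norm (x (Suc (Suc k)) - xs) < \<epsilon> / 4"
      using N2[of j] by (simp add: k(1) j_def)
    then have "E k < \<epsilon>"
      using N1(1)[of k] N1(1)[of "Suc k"] N1(2)[of "Suc k"] k(3) \<epsilon>(1) by (simp add: E_def)
    have E_small: "E i < \<epsilon>" if "i \<ge> k" for i
      using that
    proof (induction i rule: dec_induct)
      case (step i)
      then show ?case
        using E_dec[of i] \<epsilon>(3) k(2) by simp
    qed (fact \<open>E k < \<epsilon>\<close>)
    have "norm (x n - xs) < e" if "n \<ge> k + 2" for n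
    proof -
      have "n = Suc (Suc (n - 2))" "n - 2 \<ge> k" using that by auto
      then have "norm (x n - xs) \<le> E (n - 2)"
        using q_nonneg[of "Suc (n - 2)"] N0[of "Suc (n - 2)"] k(2)
        by (simp add: E_def d_def)
      then show ?thesis
        using E_small[OF \<open>n - 2 \<ge> k\<close>] \<epsilon>(2) by simp
    qed
    then show "\<exists>no. \<forall>n\<ge>no. norm (x n - xs) < e" by blast
  qed
qed

section \<open>The merit function\<close>

text \<open>
  The parameter \<open>\<delta>\<close> belongs to the algorithm but is fixed together with the problem, because the
  merit function depends on it.
\<close>

locale dca_problem =
  fixes f h \<phi> :: "'a::euclidean_space \<Rightarrow> real"
    and g :: "'a \<Rightarrow> ereal"
    and L l \<delta> :: real
  assumes f_C1: "cont_diff f"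
    and phi_C1: "cont_diff \<phi>"
    and L_pos: "L > 0"
    and l_nonneg: "l \<ge> 0"
    and convex_upper: "convex_on UNIV (\<lambda>z. L * \<phi> z - f z)"
    and convex_lower: "convex_on UNIV (\<lambda>z. l * \<phi> z + f z)"
    and g_proper: "proper g"
    and g_lsc: "lsc g"
    and g_convex: "econvex g"
    and h_convex: "convex_on UNIV h"
    and h_diff: "\<And>z. h differentiable (at z)"
    and delta: "0 < \<delta>" "\<delta> < 1"
begin

lemma f_diff: "f differentiable (at z)" and phi_diff: "\<phi> differentiable (at z)"
  using f_C1 phi_C1 by (auto simp: cont_diff_def)

lemma g_not_MInf: "g z \<noteq> - \<infinity>"
  using g_proper by (auto simp: proper_def)

text \<open>The sum of the two convex functions in the hypotheses is \<open>(L + l) * \<phi>\<close>.\<close>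

lemma phi_convex: "convex_on UNIV \<phi>"
proof -
  have "convex_on UNIV (\<lambda>z. inverse (L + l) * ((L * \<phi> z - f z) + (l * \<phi> z + f z)))"
    by (intro convex_on_cmul convex_on_add convex_upper convex_lower) (use L_pos l_nonneg in simp)
  moreover have "inverse (L + l) * ((L * \<phi> z - f z) + (l * \<phi> z + f z)) = \<phi> z" for z
  proof -
    have "L + l \<noteq> 0" using L_pos l_nonneg by simp
    moreover have "(L * \<phi> z - f z) + (l * \<phi> z + f z) = (L + l) * \<phi> z"
      by (simp add: distrib_right)
    ultimately show ?thesis by simp
  qed
  ultimately show ?thesis by simp
qed

lemma f_upper: "f z \<le> f y + (z - y) \<bullet> grad f y + L * bregman \<phi> z y"
proof -
  have "((\<lambda>z. L * \<phi> z - f z) has_derivative (\<lambda>d. d \<bullet> (L *\<^sub>R grad \<phi> y - grad f y))) (at y)"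
    using has_derivative_diff[OF has_derivative_mult_right[OF has_derivative_grad[OF phi_diff]] has_derivative_grad[OF f_diff]]
    by (simp add: inner_diff_right)
  from convex_above_gradient[OF convex_upper this, of z] show ?thesis
    by (simp add: bregman_def inner_diff_right right_diff_distrib distrib_left inner_commute)
qed

lemma f_lower: "f y + (z - y) \<bullet> grad f y - l * bregman \<phi> z y \<le> f z"
proof -
  have "((\<lambda>z. l * \<phi> z + f z) has_derivative (\<lambda>d. d \<bullet> (l *\<^sub>R grad \<phi> y + grad f y))) (at y)"
    using has_derivative_add[OF has_derivative_mult_right[OF has_derivative_grad[OF phi_diff]] has_derivative_grad[OF f_diff]]
    by (simp add: inner_add_right)
  from convex_above_gradient[OF convex_lower this, of z] show ?thesis
    by (simp add: bregman_def inner_add_right right_diff_distrib distrib_left inner_commute)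
qed

abbreviation \<Phi> :: "'a \<times> 'a \<Rightarrow> ereal" where
  "\<Phi> \<equiv> merit f g h \<phi> L \<delta>"

definition c :: real where "c = (1 + \<delta>) * L / 2"

lemma c_pos: "c > 0"
  using delta L_pos by (simp add: c_def)

lemma merit_eq: "\<Phi> (p, q) = g p + ereal (f p - h p + c * bregman \<phi> q p)"
  by (cases "g p") (simp_all add: merit_def objective_def c_def)

lemma merit_lsc: "lsc \<Phi>"
proof -
  have cont: "continuous_on UNIV f" "continuous_on UNIV h" "continuous_on UNIV \<phi>"
    using f_diff h_diff phi_diff
    by (auto simp: continuous_on_eq_continuous_at intro: differentiable_imp_continuous_within)
  have grad_cont: "continuous_on UNIV (grad \<phi>)"
    using phi_C1 by (simp add: cont_diff_def)
  have comp: "continuous_on UNIV (\<lambda>u :: 'a \<times> 'a. q (fst u))" "continuous_on UNIV (\<lambda>u :: 'a \<times> 'a. q (snd u))"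
    if "continuous_on UNIV q" for q :: "'a \<Rightarrow> 'b::topological_space"
    using continuous_on_compose2[OF that continuous_on_fst[OF continuous_on_id]]
      continuous_on_compose2[OF that continuous_on_snd[OF continuous_on_id]] by auto
  have "lsc (\<lambda>u :: 'a \<times> 'a. g (fst u))"
    by (rule lsc_compose_continuous[OF g_lsc continuous_on_fst[OF continuous_on_id]])
  then have "lsc (\<lambda>u :: 'a \<times> 'a. g (fst u) + ereal (f (fst u) - h (fst u) + c * bregman \<phi> (snd u) (fst u)))"
    unfolding bregman_def
    by (rule lsc_add_continuous)
      (intro continuous_on_add continuous_on_diff continuous_on_mult continuous_on_const
        continuous_on_inner continuous_on_fst continuous_on_snd continuous_on_id comp cont grad_cont)
  moreover have "\<Phi> = (\<lambda>u. g (fst u) + ereal (f (fst u) - h (fst u) + c * bregman \<phi> (snd u) (fst u)))"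
    using merit_eq by auto
  ultimately show ?thesis by simp
qed

text \<open>
  Each of the four terms of the merit function is bounded from below by its value at \<open>(p, q)\<close>, a linear
  term and a quadratic error: \<open>g\<close> by the subgradient, \<open>f\<close> by the weak convexity relative to \<open>\<phi>\<close>, \<open>- h\<close>
  by the Lipschitz gradient (convexity alone only bounds \<open>- h\<close> from above), and the Bregman
  term by \<open>bregman_perturbation\<close>. The linear terms in \<open>f\<close>, \<open>g\<close> and \<open>h\<close> combine to the residual
  \<open>grad f p + w - grad h p\<close> of the criticality condition.
\<close>

lemma merit_minorant:
  assumes lip: "M-lipschitz_on B (grad \<phi>)" "N-lipschitz_on B (grad h)"
    and B: "p \<in> B" "q \<in> B" "p' \<in> B"
    and w: "w \<in> subdiff g p" and fin: "g p \<noteq> \<infinity>"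
    and r: "r = norm ((p', q') - (p, q))"
  shows "\<Phi> (p, q) - ereal ((norm (grad f p + w - grad h p) + 2 * c * M * norm (q - p)) * r
      + (l * M + N + c * M) * r\<^sup>2) \<le> \<Phi> (p', q')"
proof -
  obtain gp where gp: "g p = ereal gp"
    using fin g_not_MInf[of p] by (cases "g p") auto
  have M: "M \<ge> 0" and N: "N \<ge> 0"
    using lip lipschitz_on_nonneg by blast+
  have pr: "norm (p' - p) \<le> r" and qr: "norm (q' - q) \<le> r"
    using norm_fst_le[of "p' - p" "q' - q"] norm_snd_le[of "q' - q" "p' - p"]
    by (simp_all add: r)
  then have pr2: "(norm (p' - p))\<^sup>2 \<le> r\<^sup>2"
    by (intro power_mono) auto
  show ?thesis
  proof (cases "g p'")
    case (real gp')
    have "gp + (p' - p) \<bullet> w \<le> gp'"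
      using w[unfolded subdiff_def, THEN CollectD, rule_format, of p'] by (simp add: gp real)
    moreover have "l * bregman \<phi> p' p \<le> l * M * r\<^sup>2"
    proof -
      have "bregman \<phi> p' p \<le> M * (norm (p' - p))\<^sup>2"
        by (rule convex_bregman_le[OF phi_convex phi_diff lip(1) B(3,1)])
      also have "\<dots> \<le> M * r\<^sup>2"
        using pr2 M by (rule mult_left_mono)
      finally show ?thesis
        using l_nonneg by (simp add: mult_left_mono mult.assoc)
    qed
    moreover have "h p' \<le> h p + (p' - p) \<bullet> grad h p + N * r\<^sup>2"
    proof -
      have "bregman h p' p \<le> N * (norm (p' - p))\<^sup>2"
        by (rule convex_bregman_le[OF h_convex h_diff lip(2) B(3,1)])
      also have "\<dots> \<le> N * r\<^sup>2"
        using pr2 N by (rule mult_left_mono)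
      finally show ?thesis
        by (simp add: bregman_def inner_commute)
    qed
    moreover have "c * bregman \<phi> q p - c * (2 * M * norm (q - p) * r + M * r\<^sup>2) \<le> c * bregman \<phi> q' p'"
      using mult_left_mono[OF bregman_perturbation[OF phi_convex phi_diff lip(1) B pr qr], of c] c_pos
      by (simp add: right_diff_distrib)
    moreover have "- (norm (grad f p + w - grad h p) * r) \<le> (p' - p) \<bullet> (grad f p + w - grad h p)"
    proof -
      have "\<bar>(p' - p) \<bullet> (grad f p + w - grad h p)\<bar> \<le> norm (p' - p) * norm (grad f p + w - grad h p)"
        by (rule Cauchy_Schwarz_ineq2)
      also have "\<dots> \<le> r * norm (grad f p + w - grad h p)"
        using pr by (intro mult_right_mono) auto
      finally show ?thesis by (simp add: mult.commute)
    qed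
    moreover have "(p' - p) \<bullet> (grad f p + w - grad h p) = (p' - p) \<bullet> grad f p + (p' - p) \<bullet> w - (p' - p) \<bullet> grad h p"
      by (simp add: inner_diff_right inner_add_right)
    moreover have "(norm (grad f p + w - grad h p) + 2 * c * M * norm (q - p)) * r + (l * M + N + c * M) * r\<^sup>2
        = norm (grad f p + w - grad h p) * r + l * M * r\<^sup>2 + N * r\<^sup>2
          + c * (2 * M * norm (q - p) * r + M * r\<^sup>2)"
      by (simp only: distrib_left distrib_right mult.assoc mult.commute mult.left_commute add.assoc)
    ultimately have "f p - h p + c * bregman \<phi> q p + gp
        - ((norm (grad f p + w - grad h p) + 2 * c * M * norm (q - p)) * r + (l * M + N + c * M) * r\<^sup>2)
      \<le> f p' - h p' + c * bregman \<phi> q' p' + gp'"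
      using f_lower[of p p'] by linarith
    then show ?thesis
      by (simp add: merit_eq gp real add_ac)
  next
    case MInf
    then show ?thesis using g_not_MInf by simp
  qed (simp add: merit_eq gp)
qed

lemma merit_subgradient:
  assumes lip: "M-lipschitz_on B (grad \<phi>)" "N-lipschitz_on B (grad h)"
    and B: "cball p 1 \<subseteq> B" "q \<in> B"
    and w: "w \<in> subdiff g p" and fin: "g p \<noteq> \<infinity>"
  obtains s where "s \<in> limiting_subdiff \<Phi> (p, q)"
    and "norm s \<le> 2 * (norm (grad f p + w - grad h p) + 2 * c * M * norm (q - p))"
proof (rule limiting_subgradient_of_linear_minorant[OF merit_lsc, of "(p, q)" 1
      "norm (grad f p + w - grad h p) + 2 * c * M * norm (q - p)" "l * M + N + c * M"])
  have M: "M \<ge> 0" and N: "N \<ge> 0"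
    using lip lipschitz_on_nonneg by blast+
  show "\<bar>\<Phi> (p, q)\<bar> \<noteq> \<infinity>"
    using fin g_not_MInf[of p] by (cases "g p") (auto simp: merit_eq)
  show "0 \<le> norm (grad f p + w - grad h p) + 2 * c * M * norm (q - p)" "0 \<le> l * M + N + c * M"
    using c_pos l_nonneg M N by auto
  fix u' assume u': "norm (u' - (p, q)) \<le> 1"
  obtain p' q' where pq: "u' = (p', q')" by (cases u')
  have "norm (p' - p) \<le> 1"
    using norm_fst_le[of "p' - p" "q' - q"] u' by (simp add: pq)
  then have "p \<in> B" "p' \<in> B"
    using B(1) by (auto simp: dist_norm norm_minus_commute subset_iff)
  then show "\<Phi> (p, q) - ereal ((norm (grad f p + w - grad h p) + 2 * c * M * norm (q - p)) * norm (u' - (p, q))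
      + (l * M + N + c * M) * (norm (u' - (p, q)))\<^sup>2) \<le> \<Phi> u'"
    unfolding pq using merit_minorant[OF lip _ B(2) _ w fin refl] by blast
qed (use that in auto)

end

section \<open>Sequences generated by the algorithm\<close>

locale dcae_run = dca_problem +
  fixes x y \<xi> :: "nat \<Rightarrow> 'a"
  assumes extrapolation: "(L + l) * bregman \<phi> (x k) (y k) \<le> \<delta> * L * bregman \<phi> (prev x k) (x k)"
    and \<xi>_subgradient: "\<xi> k \<in> subdiff (\<lambda>z. ereal (h z)) (x k)"
    and argmin: "is_arg_min
          (\<lambda>z. (ereal (L * \<phi> z) + g z) -
               ereal ((L *\<^sub>R grad \<phi> (y k) - grad f (y k) + \<xi> k) \<bullet> z))
          (\<lambda>_. True) (x (Suc k))"
begin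

lemma \<xi>_eq: "\<xi> k = grad h (x k)"
  using \<xi>_subgradient subdiff_differentiable[OF h_convex h_diff] by simp

text \<open>The optimality condition of the subproblem, solved for the subgradient of \<open>g\<close>.\<close>

definition v :: "nat \<Rightarrow> 'a" where
  "v k = L *\<^sub>R grad \<phi> (y k) - grad f (y k) + \<xi> k - L *\<^sub>R grad \<phi> (x (Suc k))"

lemma subproblem_min:
  "ereal (L * \<phi> (x (Suc k))) + g (x (Suc k)) - ereal ((L *\<^sub>R grad \<phi> (y k) - grad f (y k) + \<xi> k) \<bullet> x (Suc k))
    \<le> ereal (L * \<phi> z) + g z - ereal ((L *\<^sub>R grad \<phi> (y k) - grad f (y k) + \<xi> k) \<bullet> z)"
  using argmin[of k] unfolding is_arg_min_def by (simp add: not_less)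

lemma g_finite: "\<bar>g (x (Suc k))\<bar> \<noteq> \<infinity>"
proof -
  obtain z where "g z < \<infinity>"
    using g_proper by (auto simp: proper_def)
  then have "g (x (Suc k)) \<noteq> \<infinity>"
    using subproblem_min[of k z] g_not_MInf[of z] by (cases "g z") auto
  then show ?thesis
    using g_not_MInf[of "x (Suc k)"] by (cases "g (x (Suc k))") auto
qed

lemma v_subgradient: "v k \<in> subdiff g (x (Suc k))"
  unfolding v_def
proof (rule minimizer_subgradient[OF g_convex g_not_MInf _ _ subproblem_min])
  show "g (x (Suc k)) \<noteq> \<infinity>"
    using g_finite[of k] by auto
  show "((\<lambda>z. L * \<phi> z) has_derivative (\<lambda>d. d \<bullet> (L *\<^sub>R grad \<phi> (x (Suc k))))) (at (x (Suc k)))"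
    using has_derivative_mult_right[OF has_derivative_grad[OF phi_diff]] by simp
qed

text \<open>
  The index is shifted by one: \<open>g\<close> may be infinite at the starting point, while every later iterate
  solves a subproblem and so lies in the domain of \<open>g\<close>.
\<close>

definition F :: "nat \<Rightarrow> real" where
  "F k = f (x (Suc k)) + real_of_ereal (g (x (Suc k))) - h (x (Suc k))"

definition H :: "nat \<Rightarrow> real" where
  "H k = F k + c * bregman \<phi> (x k) (x (Suc k))"

lemma merit_H: "\<Phi> (x (Suc k), x k) = ereal (H k)"
  using g_finite[of k] by (cases "g (x (Suc k))") (auto simp: merit_eq H_def F_def)

lemma objective_F: "objective f g h (x (Suc k)) = ereal (F k)"
  using g_finite[of k] by (cases "g (x (Suc k))") (auto simp: objective_def F_def)

text \<open>
  Add the subgradient inequalities of \<open>g\<close> at the new iterate \<open>Z\<close> and of \<open>h\<close> at the old iterate \<open>X\<close> to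
  the two bounds on \<open>f\<close> around the extrapolated point \<open>Y\<close>. The gradients of \<open>f\<close> and the subgradients
  of \<open>h\<close> cancel, the three-point identity turns the terms in \<open>\<phi>\<close> into
  \<open>L * bregman \<phi> X Y - L * bregman \<phi> X Z\<close>, and the condition on the extrapolation parameter
  bounds the remaining \<open>(L + l) * bregman \<phi> X Y\<close>.
\<close>

lemma objective_decrease:
  "F (Suc k) \<le> F k + \<delta> * L * bregman \<phi> (x k) (x (Suc k)) - L * bregman \<phi> (x (Suc k)) (x (Suc (Suc k)))"
proof -
  define X where "X = x (Suc k)"
  define Y where "Y = y (Suc k)"
  define Z where "Z = x (Suc (Suc k))"
  obtain gX gZ where g: "g X = ereal gX" "g Z = ereal gZ"
    using g_finite[of k] g_finite[of "Suc k"] unfolding X_def Z_def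
    by (cases "g (x (Suc k))"; cases "g (x (Suc (Suc k)))") auto
  have "gZ + (X - Z) \<bullet> v (Suc k) \<le> gX"
    using v_subgradient[of "Suc k", unfolded subdiff_def, THEN CollectD, rule_format, of X] g
    by (simp add: Z_def)
  moreover have "(X - Z) \<bullet> v (Suc k) = L * ((X - Z) \<bullet> (grad \<phi> Y - grad \<phi> Z)) - (X - Z) \<bullet> grad f Y + (X - Z) \<bullet> \<xi> (Suc k)"
    by (simp add: v_def X_def Y_def Z_def inner_diff_right inner_add_right right_diff_distrib)
  moreover have "h X + (Z - X) \<bullet> \<xi> (Suc k) \<le> h Z"
    using \<xi>_subgradient[of "Suc k"] by (simp add: subdiff_def X_def)
  moreover have "(Z - X) \<bullet> \<xi> (Suc k) = - ((X - Z) \<bullet> \<xi> (Suc k))"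
    by (simp add: inner_diff_left)
  moreover have "f Z \<le> f Y + (Z - Y) \<bullet> grad f Y + L * bregman \<phi> Z Y"
    by (rule f_upper)
  moreover have "f Y + (X - Y) \<bullet> grad f Y - l * bregman \<phi> X Y \<le> f X"
    by (rule f_lower)
  moreover have "(Z - Y) \<bullet> grad f Y = (X - Y) \<bullet> grad f Y - (X - Z) \<bullet> grad f Y"
    by (simp add: inner_diff_left)
  moreover have "L * bregman \<phi> X Y = L * bregman \<phi> X Z + L * bregman \<phi> Z Y - L * ((X - Z) \<bullet> (grad \<phi> Y - grad \<phi> Z))"
    by (simp add: bregman_three_point[of \<phi> X Y Z] distrib_left inner_diff_right right_diff_distrib)
  moreover have "L * bregman \<phi> X Y + l * bregman \<phi> X Y \<le> \<delta> * L * bregman \<phi> (x k) X"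
    using extrapolation[of "Suc k"] by (simp add: prev_def X_def Y_def distrib_right)
  ultimately have "f Z + gZ - h Z \<le> f X + gX - h X + \<delta> * L * bregman \<phi> (x k) X - L * bregman \<phi> X Z"
    by linarith
  then show ?thesis
    using g by (simp add: F_def X_def Z_def)
qed

text \<open>
  The objective alone need not decrease, because the previous step enters with the factor \<open>\<delta> * L\<close>.
  The weight \<open>c\<close> in the merit function is the midpoint between \<open>\<delta> * L\<close> and \<open>L\<close>, so both the old and
  the new Bregman distance are left with the positive factor \<open>(1 - \<delta>) * L / 2\<close>. Only the new one
  is kept.
\<close>

lemma merit_decrease:
  "(1 - \<delta>) * L / 2 * bregman \<phi> (x (Suc k)) (x (Suc (Suc k))) \<le> H k - H (Suc k)"
proof -
  define D D' where "D = bregman \<phi> (x k) (x (Suc k))" and "D' = bregman \<phi> (x (Suc k)) (x (Suc (Suc k)))"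
  have "0 \<le> (1 - \<delta>) * L / 2 * D"
    using convex_bregman_nonneg[OF phi_convex phi_diff] delta L_pos by (simp add: D_def)
  moreover have "(1 - \<delta>) * L / 2 * D = c * D - \<delta> * L * D" "(1 - \<delta>) * L / 2 * D' = L * D' - c * D'"
    by (simp_all add: c_def field_simps)
  ultimately show ?thesis
    using objective_decrease[of k] unfolding H_def D_def[symmetric] D'_def[symmetric] by linarith
qed

text \<open>
  It remains to verify the hypotheses of \<open>KL_descent_convergence\<close>. The slope condition holds because
  the residual at the new iterate is a sum of differences of gradients at points whose distances are
  controlled by the last two steps; the extrapolated point is included by the parameter condition, as
  strong convexity bounds Bregman distances from below. At a cluster point the same residuals tend to
  \<open>0\<close>, so the cluster point is critical.
\<close>

theorem bounded_converges_to_critical_point: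
  assumes phi_strong: "strongly_convex \<phi>"
    and lip: "lipschitz_on_bounded (grad f)" "lipschitz_on_bounded (grad \<phi>)" "lipschitz_on_bounded (grad h)"
    and KL: "\<And>u. u \<in> dom_limiting_subdiff \<Phi> \<Longrightarrow> KL_at \<Phi> u"
    and below: "\<And>z. ereal m \<le> objective f g h z"
    and bnd: "bounded (range x)"
  shows "\<exists>xs. x \<longlonglongrightarrow> xs \<and> critical_point f g h xs"
proof -
  obtain \<rho> where \<rho>: "\<rho> > 0" "\<And>p q. \<rho> / 2 * (norm (p - q))\<^sup>2 \<le> bregman \<phi> p q"
    using strongly_convex_bregman[OF phi_strong phi_diff] by blast
  have D_nonneg: "0 \<le> bregman \<phi> p q" for p q
    by (rule convex_bregman_nonneg[OF phi_convex phi_diff])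
  define d where "d k = norm (x (Suc k) - x k)" for k
  define a where "a = (1 - \<delta>) * L / 2 * (\<rho> / 2)"
  have a: "a > 0"
    using delta L_pos \<rho> by (simp add: a_def)
  have descent: "a * (d (Suc k))\<^sup>2 \<le> H k - H (Suc k)" for k
  proof -
    have "(1 - \<delta>) * L / 2 * (\<rho> / 2 * (norm (x (Suc k) - x (Suc (Suc k))))\<^sup>2)
        \<le> (1 - \<delta>) * L / 2 * bregman \<phi> (x (Suc k)) (x (Suc (Suc k)))"
      using \<rho>(2) delta L_pos by (intro mult_left_mono) auto
    also have "\<dots> \<le> H k - H (Suc k)"
      by (rule merit_decrease)
    finally show ?thesis
      by (simp add: a_def d_def mult.assoc norm_minus_commute)
  qed
  have "decseq H"
  proof (rule decseq_SucI)
    fix k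
    have "0 \<le> a * (d (Suc k))\<^sup>2" using a by simp
    then show "H (Suc k) \<le> H k" using descent[of k] by linarith
  qed
  moreover have "m \<le> H k" for k
  proof -
    have "m \<le> F k"
      using below[of "x (Suc k)"] by (simp add: objective_F)
    moreover have "0 \<le> c * bregman \<phi> (x k) (x (Suc k))"
      using c_pos D_nonneg by simp
    ultimately show ?thesis
      by (simp add: H_def)
  qed
  ultimately obtain \<zeta> where H_lim: "H \<longlonglongrightarrow> \<zeta>"
    using decseq_convergent[of H m] by blast
  have d_lim: "d \<longlonglongrightarrow> 0"
    using sufficient_decrease_imp_vanishing[OF a descent H_lim] by (simp add: filterlim_sequentially_Suc)
  obtain M0 where M0: "M0-lipschitz_on (range x) (grad \<phi>)"
    using lip(2) bnd unfolding lipschitz_on_bounded_def by blast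
  have M0_nonneg: "M0 \<ge> 0"
    using M0 lipschitz_on_nonneg by blast
  have D_le: "bregman \<phi> (x k) (x (Suc k)) \<le> M0 * (d k)\<^sup>2" for k
    using convex_bregman_le[OF phi_convex phi_diff M0, of "x k" "x (Suc k)"]
    by (simp add: d_def norm_minus_commute)
  have D_lim: "(\<lambda>k. bregman \<phi> (x k) (x (Suc k))) \<longlonglongrightarrow> 0"
  proof -
    have "(\<lambda>k. M0 * (d k)\<^sup>2) \<longlonglongrightarrow> M0 * 0\<^sup>2"
      by (intro tendsto_intros d_lim)
    then have lim: "(\<lambda>k. M0 * (d k)\<^sup>2) \<longlonglongrightarrow> 0" by simp
    show ?thesis
      by (rule tendsto_sandwich[OF _ _ tendsto_const lim]) (simp_all add: D_nonneg D_le)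
  qed
  have F_lim: "F \<longlonglongrightarrow> \<zeta>"
  proof -
    have "(\<lambda>k. H k - c * bregman \<phi> (x k) (x (Suc k))) \<longlonglongrightarrow> \<zeta> - c * 0"
      by (intro tendsto_intros H_lim D_lim)
    then show ?thesis by (simp add: H_def)
  qed
  define A where "A = sqrt (2 * M0 / \<rho>)"
  have A: "A \<ge> 0"
    using M0_nonneg \<rho> by (simp add: A_def)
  have y_near: "norm (x (Suc k) - y (Suc k)) \<le> A * d k" for k
  proof -
    define N where "N = norm (x (Suc k) - y (Suc k))"
    have "L * (\<rho> / 2 * N\<^sup>2) \<le> L * bregman \<phi> (x (Suc k)) (y (Suc k))"
      using \<rho>(2) L_pos by (intro mult_left_mono) (auto simp: N_def)
    also have "\<dots> \<le> (L + l) * bregman \<phi> (x (Suc k)) (y (Suc k))"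
      using l_nonneg D_nonneg by (intro mult_right_mono) auto
    also have "\<dots> \<le> \<delta> * L * bregman \<phi> (x k) (x (Suc k))"
      using extrapolation[of "Suc k"] by (simp add: prev_def)
    also have "\<dots> \<le> 1 * L * (M0 * (d k)\<^sup>2)"
      using delta L_pos D_nonneg D_le by (intro mult_mono) auto
    finally have "L * (\<rho> / 2 * N\<^sup>2) \<le> L * (M0 * (d k)\<^sup>2)" by simp
    then have "\<rho> / 2 * N\<^sup>2 \<le> M0 * (d k)\<^sup>2"
      using L_pos by (simp only: mult_le_cancel_left_pos)
    then have "N\<^sup>2 \<le> 2 * M0 / \<rho> * (d k)\<^sup>2"
      using \<rho>(1) by (simp add: field_simps)
    also have "\<dots> = (A * d k)\<^sup>2"
      using M0_nonneg \<rho>(1) by (simp add: A_def power_mult_distrib)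
    finally show ?thesis
      unfolding N_def[symmetric] using A by (intro power2_le_imp_le[of N]) (auto simp: d_def)
  qed

  obtain xs r where r: "strict_mono (r :: nat \<Rightarrow> nat)" and xs: "(x \<circ> r) \<longlonglongrightarrow> xs"
    using bounded_imp_convergent_subsequence[OF bnd] by blast
  have d_r: "(\<lambda>j. d (r j)) \<longlonglongrightarrow> 0" "(\<lambda>j. d (Suc (r j))) \<longlonglongrightarrow> 0"
    using LIMSEQ_subseq_LIMSEQ[OF d_lim r] LIMSEQ_subseq_LIMSEQ[OF LIMSEQ_Suc[OF d_lim] r]
    by (simp_all add: o_def)
  have close: "Q \<longlonglongrightarrow> xs" if "P \<longlonglongrightarrow> xs" "e \<longlonglongrightarrow> 0" "\<And>j. norm (Q j - P j) \<le> e j"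
    for P Q :: "nat \<Rightarrow> 'a" and e :: "nat \<Rightarrow> real"
  proof -
    have "(\<lambda>j. Q j - P j) \<longlonglongrightarrow> 0"
      by (rule Lim_null_comparison[OF _ that(2)]) (simp add: that(3))
    from tendsto_add[OF this that(1)] show ?thesis by simp
  qed
  have x1: "(\<lambda>j. x (Suc (r j))) \<longlonglongrightarrow> xs"
    using xs d_r(1) by (rule close) (simp add: d_def)
  have x2: "(\<lambda>j. x (Suc (Suc (r j)))) \<longlonglongrightarrow> xs"
    using x1 d_r(2) by (rule close) (simp add: d_def)
  have y1: "(\<lambda>j. y (Suc (r j))) \<longlonglongrightarrow> xs"
  proof (rule close[OF x1])
    show "(\<lambda>j. A * d (r j)) \<longlonglongrightarrow> 0"
      using d_r(1) by (rule tendsto_mult_right_zero)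
    show "norm (y (Suc (r j)) - x (Suc (r j))) \<le> A * d (r j)" for j
      using y_near[of "r j"] by (simp add: norm_minus_commute)
  qed
  have cont: "(\<lambda>j. T (P j)) \<longlonglongrightarrow> T xs" if "continuous_on UNIV T" "P \<longlonglongrightarrow> xs"
    for T :: "'a \<Rightarrow> 'b::topological_space" and P :: "nat \<Rightarrow> 'a"
    using continuous_on_tendsto_compose[OF that] by simp
  have cont': "(\<lambda>j. T (P j)) \<longlonglongrightarrow> T xs" if "\<And>z. T differentiable (at z)" "P \<longlonglongrightarrow> xs"
    for T :: "'a \<Rightarrow> real" and P :: "nat \<Rightarrow> 'a"
    using isCont_tendsto_compose[OF differentiable_imp_continuous_within[OF that(1)] that(2)] .
  note grad_cont = lip[THEN lipschitz_on_bounded_imp_continuous]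
  define w where "w = grad h xs - grad f xs"
  have v_lim: "(\<lambda>j. v (Suc (r j))) \<longlonglongrightarrow> w"
  proof -
    have "(\<lambda>j. v (Suc (r j))) \<longlonglongrightarrow> L *\<^sub>R grad \<phi> xs - grad f xs + grad h xs - L *\<^sub>R grad \<phi> xs"
      unfolding v_def \<xi>_eq
      by (intro tendsto_diff tendsto_add tendsto_scaleR tendsto_const
          cont[OF grad_cont(1) y1] cont[OF grad_cont(2) y1] cont[OF grad_cont(2) x2] cont[OF grad_cont(3) x1])
    then show ?thesis
      by (simp add: w_def)
  qed
  have w: "w \<in> subdiff g xs"
    by (rule subdiff_closed[OF g_lsc x2 v_lim v_subgradient])
  have critical: "critical_point f g h xs"
  proof -
    have "grad f xs + w = grad h xs" by (simp add: w_def)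
    then have "grad h xs \<in> (\<lambda>v. grad f xs + v) ` subdiff g xs"
      using w by (metis image_eqI)
    then show ?thesis
      unfolding critical_point_def subdiff_differentiable[OF h_convex h_diff] by blast
  qed
  obtain gxs where gxs: "g xs = ereal gxs"
  proof -
    obtain z where "g z < \<infinity>"
      using g_proper by (auto simp: proper_def)
    moreover have "g xs + ereal ((z - xs) \<bullet> w) \<le> g z"
      using w by (simp add: subdiff_def)
    ultimately have "g xs \<noteq> \<infinity>" by auto
    then show thesis
      using that g_not_MInf[of xs] by (cases "g xs") auto
  qed

  \<comment> \<open>lower semicontinuity gives one bound on the limit of \<open>g\<close>, the bounded subgradients \<open>v\<close> the other\<close>
  define G where "G j = real_of_ereal (g (x (Suc (Suc (r j)))))" for j
  have G: "g (x (Suc (Suc (r j)))) = ereal (G j)" for j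
    using g_finite[of "Suc (r j)"] by (simp add: G_def ereal_real)
  have G_lim: "G \<longlonglongrightarrow> \<zeta> - f xs + h xs"
  proof -
    have "(\<lambda>j. F (Suc (r j))) \<longlonglongrightarrow> \<zeta>"
      using LIMSEQ_subseq_LIMSEQ[OF LIMSEQ_Suc[OF F_lim] r] by (simp add: o_def)
    then have "(\<lambda>j. F (Suc (r j)) - f (x (Suc (Suc (r j)))) + h (x (Suc (Suc (r j))))) \<longlonglongrightarrow> \<zeta> - f xs + h xs"
      by (intro tendsto_diff tendsto_add cont'[OF f_diff x2] cont'[OF h_diff x2])
    then show ?thesis
      by (simp add: F_def G_def[abs_def])
  qed
  have "gxs = \<zeta> - f xs + h xs"
  proof (rule antisym)
    have "(\<lambda>j. ereal (G j)) \<longlonglongrightarrow> ereal (\<zeta> - f xs + h xs)"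
      using G_lim by simp
    from lsc_sequentially[OF g_lsc x2 this] show "gxs \<le> \<zeta> - f xs + h xs"
      by (simp add: G gxs)
    have "G j + (xs - x (Suc (Suc (r j)))) \<bullet> v (Suc (r j)) \<le> gxs" for j
      using v_subgradient[of "Suc (r j)", unfolded subdiff_def, THEN CollectD, rule_format, of xs]
      by (simp add: G gxs)
    moreover have "(\<lambda>j. G j + (xs - x (Suc (Suc (r j)))) \<bullet> v (Suc (r j))) \<longlonglongrightarrow> \<zeta> - f xs + h xs + (xs - xs) \<bullet> w"
      by (intro tendsto_add tendsto_inner tendsto_diff tendsto_const G_lim x2 v_lim)
    ultimately show "\<zeta> - f xs + h xs \<le> gxs"
      by (intro LIMSEQ_le_const2[of _ "\<zeta> - f xs + h xs"]) auto
  qed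
  then have merit_xs: "\<Phi> (xs, xs) = ereal \<zeta>"
    by (simp add: merit_eq gxs bregman_def)

  have lip_bounded: "\<exists>M. M-lipschitz_on B T" if "lipschitz_on_bounded T" "bounded B" for B and T :: "'a \<Rightarrow> 'a"
    using that unfolding lipschitz_on_bounded_def by blast
  \<comment> \<open>the KL hypothesis covers only points with a limiting subgradient, so one has to be produced\<close>
  have KL_xs: "KL_at \<Phi> (xs, xs)"
  proof -
    obtain M where M: "M-lipschitz_on (cball xs 1) (grad \<phi>)"
      using lip_bounded[OF lip(2) bounded_cball] ..
    obtain N where N: "N-lipschitz_on (cball xs 1) (grad h)"
      using lip_bounded[OF lip(3) bounded_cball] ..
    obtain s where "s \<in> limiting_subdiff \<Phi> (xs, xs)"
      by (rule merit_subgradient[OF M N order_refl _ w, of xs]) (simp_all add: gxs)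
    then show ?thesis
      using KL by (auto simp: dom_limiting_subdiff_def)
  qed
  obtain R where R: "\<And>k. norm (x k) \<le> R"
    using bnd by (auto simp: bounded_iff)
  have R_nonneg: "0 \<le> R"
    using R[of 0] norm_ge_zero order_trans by blast
  \<comment> \<open>a ball containing the extrapolated points and the unit balls around all iterates\<close>
  define B where "B = cball (0::'a) (R + 2 * R * A + 1)"
  have x_B: "cball (x k) 1 \<subseteq> B" for k
  proof
    fix z assume "z \<in> cball (x k) 1"
    then have "norm (z - x k) \<le> 1"
      by (simp add: dist_norm norm_minus_commute)
    then have "norm z \<le> R + 1"
      using norm_triangle_ineq[of "z - x k" "x k"] R[of k] by simp
    moreover have "0 \<le> 2 * R * A"
      using A R_nonneg by simp
    ultimately have "norm z \<le> R + 2 * R * A + 1" by linarith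
    then show "z \<in> B" by (simp add: B_def)
  qed
  have x_B': "x k \<in> B" for k
    using x_B[of k] by auto
  have y_B: "y (Suc k) \<in> B" for k
  proof -
    have "d k \<le> 2 * R"
      using norm_triangle_ineq4[of "x (Suc k)" "x k"] R[of k] R[of "Suc k"] by (simp add: d_def)
    then have "A * d k \<le> A * (2 * R)"
      using A by (rule mult_left_mono)
    then have "norm (y (Suc k) - x (Suc k)) \<le> 2 * R * A"
      using y_near[of k] by (simp add: norm_minus_commute mult_ac)
    moreover have "norm (y (Suc k)) \<le> norm (y (Suc k) - x (Suc k)) + norm (x (Suc k))"
      using norm_triangle_ineq[of "y (Suc k) - x (Suc k)" "x (Suc k)"] by simp
    ultimately have "norm (y (Suc k)) \<le> R + 2 * R * A + 1"
      using R[of "Suc k"] by linarith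
    then show ?thesis by (simp add: B_def)
  qed
  have "bounded B" by (simp add: B_def)
  obtain Mf where Mf: "Mf-lipschitz_on B (grad f)"
    using lip_bounded[OF lip(1) \<open>bounded B\<close>] ..
  obtain M where M: "M-lipschitz_on B (grad \<phi>)"
    using lip_bounded[OF lip(2) \<open>bounded B\<close>] ..
  obtain N where N: "N-lipschitz_on B (grad h)"
    using lip_bounded[OF lip(3) \<open>bounded B\<close>] ..
  have nonneg: "0 \<le> Mf" "0 \<le> M" "0 \<le> N"
    using Mf M N lipschitz_on_nonneg by blast+
  define C where "C = 2 * ((Mf + L * M) * (1 + A) + N + 2 * c * M)"
  have C: "C \<ge> 0"
    using nonneg A L_pos c_pos by (simp add: C_def)
  have slope: "\<exists>s\<in>limiting_subdiff \<Phi> (x (Suc (Suc k)), x (Suc k)).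
      norm s \<le> C * (norm (x (Suc (Suc k)) - x (Suc k)) + norm (x (Suc k) - x k))" for k
  proof -
    define X where "X = x (Suc (Suc k))"
    define Y where "Y = y (Suc k)"
    have XY: "norm (X - Y) \<le> d (Suc k) + A * d k"
      using norm_triangle_ineq[of "X - x (Suc k)" "x (Suc k) - Y"] y_near[of k]
      by (simp add: X_def Y_def d_def)
    also have "\<dots> \<le> (1 + A) * (d (Suc k) + d k)"
      using A by (simp add: d_def algebra_simps)
    finally have XY': "norm (X - Y) \<le> (1 + A) * (d (Suc k) + d k)" .
    have "grad f X + v (Suc k) - grad h X
        = (grad f X - grad f Y) + L *\<^sub>R (grad \<phi> Y - grad \<phi> X) + (grad h (x (Suc k)) - grad h X)"
      by (simp add: v_def \<xi>_eq X_def Y_def scaleR_diff_right)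
    also have "norm \<dots> \<le> norm (grad f X - grad f Y) + L * norm (grad \<phi> Y - grad \<phi> X) + norm (grad h (x (Suc k)) - grad h X)"
      using L_pos by (intro norm_triangle_le add_mono order_refl) simp
    also have "\<dots> \<le> Mf * norm (X - Y) + L * (M * norm (X - Y)) + N * d (Suc k)"
      using lipschitz_onD[OF Mf x_B' y_B, of "Suc (Suc k)" k] lipschitz_onD[OF M y_B x_B', of k "Suc (Suc k)"]
        lipschitz_onD[OF N x_B' x_B', of "Suc k" "Suc (Suc k)"] L_pos
      by (intro add_mono mult_left_mono) (auto simp: dist_norm X_def Y_def d_def norm_minus_commute)
    also have "\<dots> = (Mf + L * M) * norm (X - Y) + N * d (Suc k)"
      by (simp add: distrib_right)
    also have "\<dots> \<le> (Mf + L * M) * ((1 + A) * (d (Suc k) + d k)) + N * (d (Suc k) + d k)"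
      using XY' nonneg L_pos by (intro add_mono mult_left_mono) (auto simp: d_def)
    finally have 1: "norm (grad f X + v (Suc k) - grad h X)
        \<le> (Mf + L * M) * ((1 + A) * (d (Suc k) + d k)) + N * (d (Suc k) + d k)" .
    have 2: "2 * c * M * norm (x (Suc k) - X) \<le> 2 * c * M * (d (Suc k) + d k)"
      using nonneg c_pos by (intro mult_left_mono) (auto simp: d_def X_def norm_minus_commute)
    have fin: "g X \<noteq> \<infinity>"
      using g_finite[of "Suc k"] by (auto simp: X_def)
    obtain s where s: "s \<in> limiting_subdiff \<Phi> (X, x (Suc k))"
      "norm s \<le> 2 * (norm (grad f X + v (Suc k) - grad h X) + 2 * c * M * norm (x (Suc k) - X))"
      unfolding X_def
      by (rule merit_subgradient[OF M N x_B x_B' v_subgradient fin[unfolded X_def]])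
    have "norm s \<le> C * (d (Suc k) + d k)"
      using s(2) 1 2 by (simp add: C_def distrib_right mult.assoc)
    then show ?thesis
      using s(1) by (auto simp: X_def d_def)
  qed
  have "x \<longlonglongrightarrow> xs"
    using KL_descent_convergence[OF KL_xs merit_xs merit_H H_lim a descent[unfolded d_def] C slope r xs] .
  then show ?thesis
    using critical by blast
qed

end

theorem theorem3p2:
  fixes f h \<phi> :: "'a::euclidean_space \<Rightarrow> real"
    and g :: "'a \<Rightarrow> ereal"
    and L l \<delta> :: real
    and x :: "nat \<Rightarrow> 'a"
  assumes f_C1: "cont_diff f"
    and phi_C1: "cont_diff \<phi>"
    and phi_strongly_convex: "strongly_convex \<phi>"
    and L_pos: "L > 0"
    and l_nonneg: "l \<ge> 0"
    and convex_upper: "convex_on UNIV (\<lambda>z. L * \<phi> z - f z)"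
    and convex_lower: "convex_on UNIV (\<lambda>z. l * \<phi> z + f z)"
    and g_proper: "proper g"
    and g_lsc: "lsc g"
    and g_convex: "econvex g"
    and h_convex: "convex_on UNIV h"
    and F_bounded_below: "\<exists>m::real. \<forall>z. ereal m \<le> objective f g h z"
    and delta: "0 < \<delta>" "\<delta> < 1"
    and x_DCAe: "DCAe_sequence f g h \<phi> L l \<delta> x"
    and KL: "\<forall>u \<in> dom_limiting_subdiff (merit f g h \<phi> L \<delta>). KL_at (merit f g h \<phi> L \<delta>) u"
    and grad_f_lipschitz: "lipschitz_on_bounded (grad f)"
    and grad_phi_lipschitz: "lipschitz_on_bounded (grad \<phi>)"
    and h_diff: "\<forall>z. h differentiable (at z)"
    and grad_h_lipschitz: "lipschitz_on_bounded (grad h)"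
    and x_bounded: "bounded (range x)"
  shows "\<exists>xs. x \<longlonglongrightarrow> xs \<and> critical_point f g h xs"
proof -
  obtain y \<beta> \<xi> where run: "\<forall>k.
        y k = x k + \<beta> k *\<^sub>R (x k - prev x k) \<and>
        (L + l) * bregman \<phi> (x k) (y k) \<le> \<delta> * L * bregman \<phi> (prev x k) (x k) \<and>
        \<xi> k \<in> subdiff (\<lambda>z. ereal (h z)) (x k) \<and>
        is_arg_min
          (\<lambda>z. (ereal (L * \<phi> z) + g z) -
               ereal ((L *\<^sub>R grad \<phi> (y k) - grad f (y k) + \<xi> k) \<bullet> z))
          (\<lambda>_. True) (x (Suc k))"
    using x_DCAe unfolding DCAe_sequence_def by (elim exE)
  obtain m where m: "\<forall>z. ereal m \<le> objective f g h z"
    using F_bounded_below by (elim exE)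
  interpret dcae_run f h \<phi> g L l \<delta> x y \<xi>
    by unfold_locales
      (fact f_C1 phi_C1 L_pos l_nonneg convex_upper convex_lower g_proper g_lsc g_convex h_convex delta
        | rule h_diff[rule_format] run[rule_format, THEN conjunct2, THEN conjunct1]
            run[rule_format, THEN conjunct2, THEN conjunct2, THEN conjunct1]
            run[rule_format, THEN conjunct2, THEN conjunct2, THEN conjunct2])+
  show ?thesis
    by (rule bounded_converges_to_critical_point[OF phi_strongly_convex grad_f_lipschitz
          grad_phi_lipschitz grad_h_lipschitz KL[rule_format] m[rule_format] x_bounded])
qed

end
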